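(* Let $q$ be a prime power, $n\ge 1$, $m\ge 1$ integers, $V=(\mathbb F_q)^n$, and $S=\mathbb F_q[x_1,\dots,x_n]$ the symmetric algebra of $V^*$, with $\mathrm{GL}_n(\mathbb F_q)$ acting on $S$ by linear substitution of the variables. Let $\mathfrak m^{[q^m]}=(x_1^{q^m},\dots,x_n^{q^m})\subset S$. For any hyperplane $H\subset V$, let $\mathrm{GL}_n(\mathbb F_q)_H=\{g\in \mathrm{GL}_n(\mathbb F_q): g|_H=\mathrm{id}_H\}$ be its pointwise stabilizer. Then $$\mathrm{Hilb}\Big(\big(S/\mathfrak m^{[q^m]}\big)^{\mathrm{GL}_n(\mathbb F_q)_H},\,t\Big)=\big([q^{m-1}]_{t^q}\big)^{n-1}{m\brack 1}_{q,t}+t^{q^m-1}\big([q^m]_t\big)^{n-1}{m\brack 0}_{q,t},$$ equivalently $$\mathrm{Hilb}\Big(\big(S/\mathfrak m^{[q^m]}\big)^{\mathrm{GL}_n(\mathbb F_q)_H},\,t\Big)=\Big(\frac{1-t^{q^m}}{1-t^q}\Big)^{n-1}\Big(\frac{1-t^{q^m-1}}{1-t^{q-1}}+t^{q^m-1}\Big(\frac{1-t^q}{1-t}\Big)^{n-1}\Big).$$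
   Context: $S$ is graded by polynomial degree ($\deg x_i=1$); the ideal $\mathfrak m^{[q^m]}$ is homogeneous and $\mathrm{GL}_n(\mathbb F_q)$-stable, so the group acts on the graded quotient $S/\mathfrak m^{[q^m]}$. For a graded vector space $M=\bigoplus_d M_d$, $\mathrm{Hilb}(M,t)=\sum_d \dim M_d\, t^d$. The $q$-integer is $[k]_u=1+u+\dots+u^{k-1}$ (so $[q^{m-1}]_{t^q}=1+t^q+\dots+t^{q(q^{m-1}-1)}$), and the $(q,t)$-binomial coefficient is ${m\brack k}_{q,t}=\prod_{i=0}^{k-1}\frac{1-t^{q^m-q^i}}{1-t^{q^k-q^i}}$ (so ${m\brack 0}_{q,t}=1$ and ${m\brack 1}_{q,t}=\frac{1-t^{q^m-1}}{1-t^{q-1}}$). *)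

theory Defs
  imports
    "HOL-Analysis.Analysis"
    "HOL-Library.Poly_Mapping"
    "HOL-Algebra.Algebraic_Closure_Type"
    "HOL-Algebra.Embedded_Algebras"
    "HOL-Computational_Algebra.Formal_Power_Series"
begin

text \<open>
  The polynomial ring \<open>S = k[x\<^sub>i : i \<in> 'n]\<close> is the monoid algebra of the monoid
  \<open>'n \<Rightarrow>\<^sub>0 nat\<close> of exponent vectors, with its type-class ring structure.
\<close>

type_synonym ('n, 'k) mpol = "('n \<Rightarrow>\<^sub>0 nat) \<Rightarrow>\<^sub>0 'k"

definition mpol_const :: "'k::zero \<Rightarrow> ('n, 'k) mpol" where
  "mpol_const c = Poly_Mapping.single 0 c"

definition mpol_var :: "'n \<Rightarrow> ('n, 'k::zero_neq_one) mpol" where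
  "mpol_var i = Poly_Mapping.single (Poly_Mapping.single i 1) 1"

definition mpol_subst ::
  "('n::finite \<Rightarrow> ('n, 'k::comm_ring_1) mpol) \<Rightarrow> ('n, 'k) mpol \<Rightarrow> ('n, 'k) mpol" where
  "mpol_subst a f =
     (\<Sum>u\<in>Poly_Mapping.keys f.
        mpol_const (Poly_Mapping.lookup f u) * (\<Prod>i\<in>UNIV. a i ^ Poly_Mapping.lookup u i))"

definition homogeneous_mpols :: "nat \<Rightarrow> ('n::finite, 'k::zero) mpol set" where
  "homogeneous_mpols d =
     {f. \<forall>u\<in>Poly_Mapping.keys f. (\<Sum>i\<in>UNIV. Poly_Mapping.lookup u i) = d}"

text \<open>
  The variables are the coordinate functions on \<open>V = k\<^sup>n\<close>, so \<open>g\<close> acts on a linear form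
  \<open>x \<in> V\<^sup>*\<close> by \<open>x \<mapsto> x \<circ> g\<^sup>-\<^sup>1\<close>, that is, by
  \<open>x\<^sub>i \<mapsto> \<Sum>\<^sub>j (g\<^sup>-\<^sup>1)\<^sub>i\<^sub>j x\<^sub>j\<close>.
\<close>

definition GL_act ::
  "'k::field ^ 'n ^ 'n \<Rightarrow> ('n::finite, 'k) mpol \<Rightarrow> ('n, 'k) mpol" where
  "GL_act g = mpol_subst (\<lambda>i. \<Sum>j\<in>UNIV. mpol_const (matrix_inv g $ i $ j) * mpol_var j)"

definition GL_fixing :: "('k::field ^ 'n::finite) set \<Rightarrow> ('k ^ 'n ^ 'n) set" where
  "GL_fixing H = {g. invertible g \<and> (\<forall>v\<in>H. g *v v = v)}"

definition is_hyperplane :: "('k::field ^ 'n::finite) set \<Rightarrow> bool" where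
  "is_hyperplane H \<longleftrightarrow> vec.subspace H \<and> vec.dim H = CARD('n) - 1"

abbreviation mpol_ring :: "('n, 'k::comm_ring_1) mpol ring" where
  "mpol_ring \<equiv> ring_of_type_algebra"

definition frob_ideal :: "nat \<Rightarrow> ('n, 'k::comm_ring_1) mpol set" where
  "frob_ideal N = genideal mpol_ring (range (\<lambda>i. mpol_var i ^ N))"

definition quot_scalars :: "('n, 'k::comm_ring_1) mpol set \<Rightarrow> ('n, 'k) mpol set set" where
  "quot_scalars I = range (\<lambda>c. I +>\<^bsub>mpol_ring\<^esub> mpol_const c)"

definition quot_component ::
  "('n::finite, 'k::comm_ring_1) mpol set \<Rightarrow> nat \<Rightarrow> ('n, 'k) mpol set set" where
  "quot_component I d = (\<lambda>f. I +>\<^bsub>mpol_ring\<^esub> f) ` homogeneous_mpols d"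

text \<open>
  Elements of the quotient are cosets. For a stable ideal \<open>I\<close> the induced action is
  \<open>g \<cdot> (f + I) = g f + I\<close>, which is the image of the coset under the action of \<open>g\<close>.
\<close>

definition quot_invariants ::
  "('k::field ^ 'n ^ 'n) set \<Rightarrow> ('n::finite, 'k) mpol set \<Rightarrow> ('n, 'k) mpol set set" where
  "quot_invariants G I = {C \<in> carrier (mpol_ring Quot I). \<forall>g\<in>G. GL_act g ` C = C}"

text \<open>
  The Hilbert series of a graded subspace \<open>M\<close> of \<open>S/I\<close>, whose degree \<open>d\<close> component is
  \<open>M \<inter> (S/I)\<^sub>d\<close>.
\<close>

definition Hilb :: "('n::finite, 'k::field) mpol set \<Rightarrow> ('n, 'k) mpol set set \<Rightarrow> rat fps" where
  "Hilb I M =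
     Abs_fps (\<lambda>d. of_nat (ring.dim (mpol_ring Quot I) (quot_scalars I) (M \<inter> quot_component I d)))"

definition qint :: "nat \<Rightarrow> 'a::comm_semiring_1 \<Rightarrow> 'a" where
  "qint k u = (\<Sum>i<k. u ^ i)"

text \<open>
  The denominators below are units of the power series ring for \<open>q \<ge> 2\<close>, and the truncated
  subtraction in the exponents is exact for \<open>k \<le> m\<close>.
\<close>

definition qt_binomial :: "nat \<Rightarrow> nat \<Rightarrow> nat \<Rightarrow> rat fps" where
  "qt_binomial q m k =
     (\<Prod>i<k. (1 - fps_X ^ (q ^ m - q ^ i)) / (1 - fps_X ^ (q ^ k - q ^ i)))"

end

theory Submission
  imports Defs
begin

text \<open>
  In coordinates with \<open>H = {z = 0}\<close> the group consists of the substitutions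
  \<open>x\<^sub>i \<mapsto> x\<^sub>i + c\<^sub>i z\<close>, \<open>z \<mapsto> \<alpha> z\<close> with \<open>\<alpha> \<noteq> 0\<close>. Put \<open>Q = q\<^sup>m\<close> and
  \<open>N\<^sub>i = x\<^sub>i\<^sup>q - x\<^sub>i z\<^sup>q\<^sup>-\<^sup>1\<close>. Modulo the ideal generated by the \<open>Q\<close>-th powers, the invariants have as
  basis the monomials divisible by \<open>z\<^sup>Q\<^sup>-\<^sup>1\<close> together with the products of \<open>z\<^sup>j\<close>, where
  \<open>j < Q - 1\<close> is divisible by \<open>q - 1\<close>, and powers \<open>N\<^sub>i\<^sup>b\<close> with \<open>b < q\<^sup>m\<^sup>-\<^sup>1\<close>. Independence is visible on
  the terms of lowest order in \<open>z\<close>. Conversely, let \<open>z\<^sup>j g(x)\<close> be the part of lowest order of an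
  invariant. The scalings of \<open>z\<close> force \<open>q - 1\<close> to divide \<open>j\<close>; if \<open>j < Q - 1\<close> this leaves room for \<open>q - 1\<close> further
  orders in \<open>z\<close>, and the vanishing of polynomials in \<open>c\<^sub>i\<close> of degree less than \<open>q\<close> forces \<open>g\<close> to be a
  polynomial in the \<open>x\<^sub>i\<^sup>q\<close>. Subtracting basis elements raises the order.
\<close>

section \<open>Finite fields and binomial coefficients over them\<close>

lemma minus_1_dvd_power_minus_1: "q - 1 dvd q ^ m - 1" for q :: nat
proof (induction m)
  case (Suc m)
  show ?case
  proof (cases "q = 0")
    case False
    hence "q ^ m \<ge> 1" by simp
    hence "q ^ Suc m - 1 = q * (q ^ m - 1) + (q - 1)"
      using False by (simp add: diff_mult_distrib2)
    thus ?thesis using Suc by (simp add: dvd_add)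
  qed simp
qed simp

lemma card_field_ge_2: "CARD('k::{field,finite}) \<ge> 2"
proof -
  have "card {0, 1::'k} \<le> CARD('k)" by (rule card_mono) auto
  thus ?thesis by simp
qed

text \<open>Multiplication by \<open>x\<close> permutes the nonzero elements, so their product is
  unchanged by a factor \<open>x ^ (q - 1)\<close>; that product is nonzero and cancels.\<close>

lemma finite_field_power_card_minus_1:
  fixes x :: "'k::{field,finite}"
  assumes "x \<noteq> 0"
  shows "x ^ (CARD('k) - 1) = 1"
proof -
  let ?U = "UNIV - {0::'k}"
  have "bij_betw ((*) x) ?U ?U"
    by (rule bij_betwI[where g = "\<lambda>y. y / x"]) (use assms in auto)
  hence "(\<Prod>y\<in>?U. x * y) = \<Prod>?U"
    by (rule prod.reindex_bij_betw)
  hence "x ^ card ?U * \<Prod>?U = 1 * \<Prod>?U"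
    by (simp add: prod.distrib)
  moreover have "\<Prod>?U \<noteq> 0" by simp
  ultimately show ?thesis
    by (simp only: mult_cancel_right) (simp add: card_Diff_singleton)
qed

lemma finite_field_power_card:
  fixes x :: "'k::{field,finite}"
  shows "x ^ CARD('k) = x"
proof (cases "x = 0")
  case False
  have "x ^ CARD('k) = x ^ Suc (CARD('k) - 1)"
    using card_field_ge_2[where 'k = 'k] by simp
  also have "\<dots> = x" by (simp only: power_Suc finite_field_power_card_minus_1[OF False]) simp
  finally show ?thesis .
qed simp

lemma finite_field_power_card_power:
  fixes x :: "'k::{field,finite}"
  shows "x ^ (CARD('k) ^ m) = x"
  by (induction m) (simp_all add: power_mult finite_field_power_card)

lemma poly_eq_0_if_vanishes_on_finite_field:
  fixes p :: "'k::{field,finite} poly"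
  assumes "Polynomial.degree p < CARD('k)" and "\<And>x. poly p x = 0"
  shows "p = 0"
proof (rule ccontr)
  assume "p \<noteq> 0"
  hence "card {x. poly p x = 0} \<le> Polynomial.degree p"
    by (rule card_poly_roots_bound)
  thus False using assms by simp
qed

lemma card_minus_1_dvd_if_power_eq_1:
  assumes "\<And>x :: 'k::{field,finite}. x \<noteq> 0 \<Longrightarrow> x ^ j = 1"
  shows "(CARD('k) - 1) dvd j"
proof (rule ccontr)
  let ?q = "CARD('k)"
  define r where "r = j mod (?q - 1)"
  \<comment> \<open>The extra factor \<open>X\<close> in \<open>X ^ (r + 1) - X\<close> makes the
    polynomial vanish at 0 as well, and \<open>r < q - 1\<close> keeps its degree below
    \<open>q\<close>.\<close>
  define p :: "'k poly" where "p = Polynomial.monom 1 (Suc r) - Polynomial.monom 1 1"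
  assume "\<not> (?q - 1) dvd j"
  hence r: "r \<noteq> 0" "r < ?q - 1"
    using card_field_ge_2[where 'k = 'k] by (auto simp: r_def mod_eq_0_iff_dvd)
  have pow: "x ^ r = 1" if "x \<noteq> 0" for x :: 'k
  proof -
    have "x ^ j = x ^ ((?q - 1) * (j div (?q - 1)) + r)" by (simp add: r_def)
    also have "\<dots> = x ^ r"
      by (simp only: power_add power_mult finite_field_power_card_minus_1[OF that] power_one mult_1_left)
    finally show ?thesis using assms[OF that] by simp
  qed
  have "poly p x = 0" for x
    using pow[of x] by (cases "x = 0") (simp_all add: p_def poly_monom)
  moreover have "Polynomial.degree p < ?q"
    unfolding p_def using r by (intro degree_diff_less) (auto simp: degree_monom_eq)
  ultimately have "p = 0" by (intro poly_eq_0_if_vanishes_on_finite_field)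
  hence "poly.coeff p 1 = 0" by simp
  thus False using r by (simp add: p_def)
qed

text \<open>Because \<open>x ^ q = x\<close> throughout the field, comparing
  \<open>(x + 1) ^ q\<close> with \<open>x + 1\<close> shows that the middle binomial terms sum to
  zero for every \<open>x\<close>. They form a polynomial of degree below \<open>q\<close>, so every
  coefficient vanishes.\<close>

lemma of_nat_card_choose_eq_0:
  assumes "0 < e" "e < CARD('k)"
  shows "(of_nat (CARD('k) choose e) :: 'k::{field,finite}) = 0"
proof -
  let ?q = "CARD('k)"
  let ?c = "\<lambda>e. of_nat (?q choose e) :: 'k"
  define p :: "'k poly" where "p = (\<Sum>e\<in>{0<..<?q}. Polynomial.monom (?c e) e)"
  have "Polynomial.degree p \<le> ?q - 1"
    unfolding p_def by (rule degree_sum_le) (auto intro: order.trans[OF degree_monom_le])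
  hence deg: "Polynomial.degree p < ?q"
    using card_field_ge_2[where 'k = 'k] by linarith
  have "poly p x = 0" for x
  proof -
    have "x + 1 = (x + 1) ^ ?q" by (simp add: finite_field_power_card)
    also have "\<dots> = (\<Sum>k\<le>?q. ?c k * x ^ k)" by (simp add: binomial_ring)
    also have "{..?q} = insert 0 (insert ?q {0<..<?q})"
      using card_field_ge_2[where 'k = 'k] by auto
    also have "(\<Sum>k\<in>\<dots>. ?c k * x ^ k) = 1 + (x + poly p x)"
      by (subst sum.insert; simp add: p_def poly_sum poly_monom finite_field_power_card)+
    finally show ?thesis by simp
  qed
  hence "p = 0" using deg by (intro poly_eq_0_if_vanishes_on_finite_field)
  hence "poly.coeff p e = 0" by simp
  thus ?thesis using assms by (simp add: p_def Polynomial.coeff_sum)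
qed

text \<open>Induction on \<open>s\<close> with Vandermonde's identity for \<open>q + s * q\<close>:
  the term \<open>k = 0\<close> dies by the induction hypothesis, every other term by the vanishing
  of \<open>q choose k\<close>.\<close>

lemma of_nat_mult_card_choose_eq_0:
  assumes "0 < e" "e < CARD('k)"
  shows "(of_nat (s * CARD('k) choose e) :: 'k::{field,finite}) = 0"
  using assms
proof (induction s)
  case (Suc s)
  have "of_nat (CARD('k) choose k) * of_nat (s * CARD('k) choose (e - k)) = (0::'k)"
    if "k \<le> e" for k
    using Suc that of_nat_card_choose_eq_0[of k, where 'k = 'k] by (cases "k = 0") auto
  thus ?case by (auto simp flip: vandermonde intro!: sum.neutral)
qed (simp add: binomial_eq_0)

text \<open>The special case of Lucas' theorem that picks out the lowest base-\<open>q\<close> digit.\<close>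

lemma of_nat_choose_mod_card_eq_1:
  "(of_nat (a choose (a mod CARD('k))) :: 'k::{field,finite}) = 1"
proof -
  let ?q = "CARD('k)"
  let ?s = "a div ?q" and ?r = "a mod ?q"
  have r: "?r < ?q" using card_field_ge_2[where 'k = 'k] by simp
  have "(of_nat ((?s * ?q + ?r) choose ?r) :: 'k)
      = (\<Sum>k\<le>?r. of_nat ((?s * ?q) choose k) * of_nat (?r choose (?r - k)))"
    by (simp only: of_nat_sum of_nat_mult flip: vandermonde)
  also have "\<dots> = (\<Sum>k\<in>{0}. of_nat ((?s * ?q) choose k) * of_nat (?r choose (?r - k)))"
  proof (intro sum.mono_neutral_right ballI)
    fix k assume "k \<in> {..?r} - {0}"
    hence "0 < k" "k \<le> ?r" by auto
    hence "0 < k" "k < ?q" using r by linarith+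
    thus "of_nat ((?s * ?q) choose k) * of_nat (?r choose (?r - k)) = (0::'k)"
      by (simp add: of_nat_mult_card_choose_eq_0)
  qed auto
  finally show ?thesis by simp
qed

section \<open>Polynomial substitution\<close>

lemma mpol_const_simps [simp]:
  "mpol_const 0 = 0" "mpol_const 1 = 1"
  "mpol_const (a + b) = mpol_const a + mpol_const b"
  "mpol_const (a * b) = mpol_const a * mpol_const b"
  for a b :: "'k::comm_ring_1"
  by (simp_all add: mpol_const_def single_add mult_single)

lemma mpol_const_minus: "mpol_const (- a) = - mpol_const a"
  for a :: "'k::comm_ring_1"
  by (simp add: mpol_const_def single_uminus)

lemma mpol_const_power: "mpol_const (a ^ n) = mpol_const a ^ n"
  for a :: "'k::comm_ring_1"
  by (induction n) simp_all

lemma mpol_const_sum: "mpol_const (sum g T) = (\<Sum>x\<in>T. mpol_const (g x))"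
  for g :: "'a \<Rightarrow> 'k::comm_ring_1"
  by (induction T rule: infinite_finite_induct) simp_all

lemma of_nat_mpol: "of_nat n = mpol_const (of_nat n :: 'k::comm_ring_1)"
  by (induction n) simp_all

lemma mpol_const_mult_single:
  "mpol_const c * Poly_Mapping.single u d = Poly_Mapping.single u (c * d :: 'k::comm_ring_1)"
  by (simp add: mpol_const_def mult_single)

lemma poly_mapping_eq_sum_single:
  assumes "finite S" "Poly_Mapping.keys f \<subseteq> S"
  shows "f = (\<Sum>u\<in>S. Poly_Mapping.single u (Poly_Mapping.lookup f u))"
proof (rule poly_mapping_eqI)
  fix k
  have "(\<Sum>u\<in>S. Poly_Mapping.lookup (Poly_Mapping.single u (Poly_Mapping.lookup f u)) k)
      = (\<Sum>u\<in>S. if u = k then Poly_Mapping.lookup f u else 0)"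
    by (intro sum.cong) (auto simp: lookup_single)
  also have "\<dots> = Poly_Mapping.lookup f k"
    using assms by (auto simp: sum.delta in_keys_iff)
  finally show "Poly_Mapping.lookup f k
      = Poly_Mapping.lookup (\<Sum>u\<in>S. Poly_Mapping.single u (Poly_Mapping.lookup f u)) k"
    by (simp add: lookup_sum)
qed

lemma lookup_const_mult [simp]:
  "Poly_Mapping.lookup (mpol_const c * f) u = (c :: 'k::comm_ring_1) * Poly_Mapping.lookup f u"
proof -
  have "mpol_const c * f = Poly_Mapping.map ((*) c) f"
    by (simp add: mpol_const_def mult_map_scale_conv_mult)
  thus ?thesis by (simp add: Poly_Mapping.map.rep_eq when_def)
qed

lemma mpol_var_power:
  "mpol_var i ^ k = (Poly_Mapping.single (Poly_Mapping.single i k) 1 :: ('n, 'k::comm_ring_1) mpol)"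
  by (induction k) (simp_all add: mpol_var_def mult_single flip: single_add)

lemma prod_single:
  "finite T \<Longrightarrow> (\<Prod>x\<in>T. Poly_Mapping.single (g x) (1::'k::comm_ring_1))
     = Poly_Mapping.single (\<Sum>x\<in>T. g x) 1"
  by (induction T rule: finite_induct) (simp_all add: mult_single)

lemma sum_single_lookup:
  "(\<Sum>i\<in>UNIV. Poly_Mapping.single i (Poly_Mapping.lookup u i)) = (u :: 'n::finite \<Rightarrow>\<^sub>0 nat)"
  using poly_mapping_eq_sum_single[of UNIV u] by simp

lemma prod_mpol_var_power:
  "(\<Prod>i\<in>UNIV. mpol_var i ^ Poly_Mapping.lookup u i)
     = (Poly_Mapping.single u 1 :: ('n::finite, 'k::comm_ring_1) mpol)"
  by (simp add: mpol_var_power prod_single sum_single_lookup)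

text \<open>Cancellation can make the support of \<open>f + g\<close> smaller than the union of the
  supports; a common index set lets the substitution sums be compared termwise.\<close>

lemma mpol_subst_superset:
  fixes a :: "'n::finite \<Rightarrow> ('n, 'k::comm_ring_1) mpol"
  assumes "finite S" "Poly_Mapping.keys f \<subseteq> S"
  shows "mpol_subst a f =
     (\<Sum>u\<in>S. mpol_const (Poly_Mapping.lookup f u) * (\<Prod>i\<in>UNIV. a i ^ Poly_Mapping.lookup u i))"
  unfolding mpol_subst_def using assms
  by (intro sum.mono_neutral_left) (auto simp: in_keys_iff)

lemma mpol_subst_add [simp]: "mpol_subst a (f + g) = mpol_subst a f + mpol_subst a g"
proof -
  let ?S = "Poly_Mapping.keys f \<union> Poly_Mapping.keys g"
  have "Poly_Mapping.keys (f + g) \<subseteq> ?S" by (rule Poly_Mapping.keys_add)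
  thus ?thesis
    by (simp add: mpol_subst_superset[of ?S] lookup_add algebra_simps sum.distrib)
qed

lemma mpol_subst_0 [simp]: "mpol_subst a 0 = 0"
  by (simp add: mpol_subst_def)

lemma mpol_subst_sum: "mpol_subst a (sum g T) = (\<Sum>x\<in>T. mpol_subst a (g x))"
  by (induction T rule: infinite_finite_induct) simp_all

lemma mpol_subst_single:
  "mpol_subst a (Poly_Mapping.single u c)
     = mpol_const c * (\<Prod>i\<in>UNIV. a i ^ Poly_Mapping.lookup u i)"
  by (subst mpol_subst_superset[of "{u}"]) (auto split: if_splits)

lemma mpol_subst_const [simp]: "mpol_subst a (mpol_const c) = mpol_const c"
  using mpol_subst_single[of a 0 c] by (simp add: mpol_const_def)

lemma mpol_subst_mult [simp]: "mpol_subst a (f * g) = mpol_subst a f * mpol_subst a g"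
proof -
  have single: "mpol_subst a (Poly_Mapping.single u c * Poly_Mapping.single v d)
      = mpol_subst a (Poly_Mapping.single u c) * mpol_subst a (Poly_Mapping.single v d)" for u v c d
    by (simp add: mult_single mpol_subst_single lookup_add power_add prod.distrib mult_ac)
  have f: "f = (\<Sum>u\<in>Poly_Mapping.keys f. Poly_Mapping.single u (Poly_Mapping.lookup f u))" (is "f = ?f")
    by (rule poly_mapping_eq_sum_single) auto
  have g: "g = (\<Sum>u\<in>Poly_Mapping.keys g. Poly_Mapping.single u (Poly_Mapping.lookup g u))" (is "g = ?g")
    by (rule poly_mapping_eq_sum_single) auto
  have "mpol_subst a (?f * ?g) = mpol_subst a ?f * mpol_subst a ?g"
    by (simp add: sum_product mpol_subst_sum single)
  thus ?thesis using f g by simp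
qed

lemma mpol_subst_1 [simp]: "mpol_subst a 1 = 1"
  using mpol_subst_const[of a 1] by (simp del: mpol_subst_const)

lemma mpol_subst_power [simp]: "mpol_subst a (f ^ n) = mpol_subst a f ^ n"
  by (induction n) simp_all

lemma mpol_subst_prod: "mpol_subst a (prod g T) = (\<Prod>x\<in>T. mpol_subst a (g x))"
  by (induction T rule: infinite_finite_induct) simp_all

lemma mpol_subst_diff [simp]: "mpol_subst a (f - g) = mpol_subst a f - mpol_subst a g"
  by (metis add_diff_cancel_right' diff_add_cancel mpol_subst_add)

lemma mpol_subst_var [simp]: "mpol_subst a (mpol_var i) = a i"
proof -
  have "(\<Prod>j\<in>UNIV. a j ^ (Poly_Mapping.lookup (Poly_Mapping.single i 1) j))
      = (\<Prod>j\<in>UNIV. if j = i then a j else 1)"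
    by (intro prod.cong) (auto simp: lookup_single)
  thus ?thesis by (simp add: mpol_var_def mpol_subst_single)
qed

lemma mpol_subst_subst: "mpol_subst a (mpol_subst b f) = mpol_subst (\<lambda>i. mpol_subst a (b i)) f"
  by (subst (1 2) mpol_subst_def) (simp add: mpol_subst_sum mpol_subst_prod del: mpol_subst_def)

lemma mpol_subst_var_id [simp]: "mpol_subst mpol_var f = f"
  by (simp add: mpol_subst_def prod_mpol_var_power mpol_const_mult_single
      flip: poly_mapping_eq_sum_single)

section \<open>The Frobenius endomorphism of the polynomial ring\<close>

lemma Frobenius_mpol_add:
  fixes f g :: "('n, 'k::{field,finite}) mpol"
  shows "(f + g) ^ CARD('k) = f ^ CARD('k) + g ^ CARD('k)"
proof -
  let ?q = "CARD('k)"
  have "(f + g) ^ ?q = (\<Sum>k\<le>?q. of_nat (?q choose k) * f ^ k * g ^ (?q - k))"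
    by (rule binomial_ring)
  also have "\<dots> = (\<Sum>k\<in>{0, ?q}. of_nat (?q choose k) * f ^ k * g ^ (?q - k))"
    by (rule sum.mono_neutral_right) (auto simp: of_nat_mpol of_nat_card_choose_eq_0)
  finally show ?thesis by simp
qed

lemma Frobenius_mpol_sum:
  fixes g :: "'a \<Rightarrow> ('n, 'k::{field,finite}) mpol"
  shows "(sum g T) ^ (CARD('k) ^ m) = (\<Sum>x\<in>T. g x ^ (CARD('k) ^ m))"
proof (induction m arbitrary: g)
  case (Suc m)
  have "(sum g T) ^ CARD('k) = (\<Sum>x\<in>T. g x ^ CARD('k))"
    by (induction T rule: infinite_finite_induct) (simp_all add: Frobenius_mpol_add zero_power)
  thus ?case by (simp add: power_mult Suc)
qed simp

section \<open>Quotients of the polynomial ring\<close>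

lemma mpol_ring_simps [simp]:
  "carrier ring_of_type_algebra = UNIV"
  "x \<otimes>\<^bsub>ring_of_type_algebra\<^esub> y = x * y"
  "x \<oplus>\<^bsub>ring_of_type_algebra\<^esub> y = x + y"
  "\<one>\<^bsub>ring_of_type_algebra\<^esub> = 1"
  "\<zero>\<^bsub>ring_of_type_algebra\<^esub> = 0"
  by (simp_all add: ring_of_type_algebra_def)

lemma mpol_ring_a_inv [simp]: "\<ominus>\<^bsub>ring_of_type_algebra\<^esub> x = - (x :: 'a::comm_ring_1)"
proof -
  interpret R: ring "ring_of_type_algebra :: 'a ring" by (rule ring_from_type_algebra)
  show ?thesis by (rule R.minus_equality) auto
qed

lemma ideal_type_algebraI:
  fixes I :: "'a::comm_ring_1 set"
  assumes "0 \<in> I" "\<And>f g. f \<in> I \<Longrightarrow> g \<in> I \<Longrightarrow> f + g \<in> I"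
    "\<And>f h. f \<in> I \<Longrightarrow> h * f \<in> I"
  shows "ideal I ring_of_type_algebra"
proof (rule idealI)
  interpret R: ring "ring_of_type_algebra :: 'a ring" by (rule ring_from_type_algebra)
  show "ring (ring_of_type_algebra :: 'a ring)" by (rule R.ring_axioms)
  show "subgroup I (add_monoid (ring_of_type_algebra :: 'a ring))"
  proof (rule R.add.subgroupI)
    fix f assume "f \<in> I"
    thus "\<ominus>\<^bsub>ring_of_type_algebra\<^esub> f \<in> I" using assms(3)[of f "- 1"] by simp
  qed (use assms in auto)
qed (use assms in \<open>auto simp: mult.commute\<close>)

context
  fixes I :: "'a::comm_ring_1 set"
  assumes I: "ideal I ring_of_type_algebra"
begin

interpretation I: ideal I "ring_of_type_algebra :: 'a ring" by (rule I)

lemma ideal_type_algebra_closed: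
  shows "0 \<in> I" "f \<in> I \<Longrightarrow> g \<in> I \<Longrightarrow> f + g \<in> I" "f \<in> I \<Longrightarrow> h * f \<in> I"
    "f \<in> I \<Longrightarrow> - f \<in> I" "f \<in> I \<Longrightarrow> g \<in> I \<Longrightarrow> f - g \<in> I"
proof -
  show [intro]: "0 \<in> I" using additive_subgroup.zero_closed[OF ideal.axioms(1)[OF I]] by simp
  show a: "f \<in> I \<Longrightarrow> g \<in> I \<Longrightarrow> f + g \<in> I" for f g using additive_subgroup.a_closed[OF ideal.axioms(1)[OF I], of f g] by simp
  show m: "f \<in> I \<Longrightarrow> h * f \<in> I" for f h using I.I_l_closed[of f h] by simp
  show n: "f \<in> I \<Longrightarrow> - f \<in> I" for f using m[of f "- 1"] by simp
  show "f \<in> I \<Longrightarrow> g \<in> I \<Longrightarrow> f - g \<in> I" using a[of f "- g"] n[of g] by simp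
qed

lemma ideal_type_algebra_sum: "(\<And>x. x \<in> T \<Longrightarrow> g x \<in> I) \<Longrightarrow> sum g T \<in> I"
  by (induction T rule: infinite_finite_induct) (auto intro: ideal_type_algebra_closed)

lemma coset_type_algebra: "I +>\<^bsub>ring_of_type_algebra\<^esub> f = {h. h - f \<in> I}"
proof -
  have "h \<in> I +>\<^bsub>ring_of_type_algebra\<^esub> f \<longleftrightarrow> h - f \<in> I" for h
    by (auto simp: a_r_coset_def r_coset_def) (metis diff_add_cancel)
  thus ?thesis by blast
qed

lemma coset_type_algebra_eq_iff:
  "I +>\<^bsub>ring_of_type_algebra\<^esub> f = I +>\<^bsub>ring_of_type_algebra\<^esub> g \<longleftrightarrow> f - g \<in> I"
proof
  assume "I +>\<^bsub>ring_of_type_algebra\<^esub> f = I +>\<^bsub>ring_of_type_algebra\<^esub> g"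
  moreover have "f \<in> I +>\<^bsub>ring_of_type_algebra\<^esub> f"
    by (simp add: coset_type_algebra ideal_type_algebra_closed)
  ultimately show "f - g \<in> I" by (simp add: coset_type_algebra)
next
  assume fg: "f - g \<in> I"
  have "h - f \<in> I \<longleftrightarrow> h - g \<in> I" for h
    using ideal_type_algebra_closed(2)[OF _ fg, of "h - f"]
      ideal_type_algebra_closed(5)[OF _ fg, of "h - g"] by auto
  thus "I +>\<^bsub>ring_of_type_algebra\<^esub> f = I +>\<^bsub>ring_of_type_algebra\<^esub> g"
    by (auto simp: coset_type_algebra)
qed

lemma carrier_Quot_type_algebra:
  "carrier (ring_of_type_algebra Quot I) = range (\<lambda>f. I +>\<^bsub>ring_of_type_algebra\<^esub> f)"
  by (auto simp: FactRing_def A_RCOSETS_def RCOSETS_def a_r_coset_def)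

end

section \<open>Dimension over the constants in a quotient of the polynomial ring\<close>

lemma subfield_mpol_const:
  "subfield (range mpol_const) (mpol_ring :: ('n, 'k::field) mpol ring)"
proof -
  let ?R = "mpol_ring :: ('n, 'k) mpol ring"
  interpret R: cring ?R by (rule cring_from_type_algebra)
  have sub: "subring (range mpol_const) ?R"
  proof (rule R.subringI)
    show "\<one>\<^bsub>?R\<^esub> \<in> range mpol_const" by (auto intro: image_eqI[of _ _ 1])
  next
    fix h :: "('n, 'k) mpol" assume "h \<in> range mpol_const"
    then obtain a where "h = mpol_const a" by blast
    thus "\<ominus>\<^bsub>?R\<^esub> h \<in> range mpol_const" by (auto intro: image_eqI[of _ _ "- a"] simp: mpol_const_minus)
  next
    fix h1 h2 :: "('n, 'k) mpol" assume "h1 \<in> range mpol_const" "h2 \<in> range mpol_const"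
    then obtain a b where ab: "h1 = mpol_const a" "h2 = mpol_const b" by blast
    show "h1 \<otimes>\<^bsub>?R\<^esub> h2 \<in> range mpol_const" using ab by (auto intro: image_eqI[of _ _ "a * b"])
    show "h1 \<oplus>\<^bsub>?R\<^esub> h2 \<in> range mpol_const" using ab by (auto intro: image_eqI[of _ _ "a + b"])
  qed simp
  have nz: "mpol_const c = (0 :: ('n, 'k) mpol) \<longleftrightarrow> c = 0" for c
    by (metis lookup_single_eq lookup_zero mpol_const_def single_zero)
  show ?thesis
  proof (rule R.subfieldI)
    show "subcring (range mpol_const) ?R" by (rule R.subcringI'[OF sub])
    show "Units (?R\<lparr>carrier := range mpol_const\<rparr>) = range mpol_const - {\<zero>\<^bsub>?R\<^esub>}"
    proof (intro equalityI subsetI)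
      fix x assume "x \<in> Units (?R\<lparr>carrier := range mpol_const\<rparr>)"
      hence "x \<in> range mpol_const" "\<exists>y. y * x = 1" by (auto simp: Units_def)
      thus "x \<in> range mpol_const - {\<zero>\<^bsub>?R\<^esub>}" by auto
    next
      fix x assume "x \<in> range mpol_const - {\<zero>\<^bsub>?R\<^esub>}"
      then obtain c where c: "x = mpol_const c" "c \<noteq> 0" by (auto simp: nz)
      hence "mpol_const (inverse c) * x = 1"
        by (simp flip: mpol_const_simps(2,4))
      thus "x \<in> Units (?R\<lparr>carrier := range mpol_const\<rparr>)"
        using c(1) by (auto simp: Units_def mult.commute)
    qed
  qed
qed

text \<open>Bridge from polynomial identities modulo \<open>I\<close> to the dimension of a subspace
  of the quotient. The span is built one vector at a time, following the inductive definition of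
  \<open>dimension\<close>; independence modulo \<open>I\<close> keeps each new vector out of the
  span of the previous ones. That \<open>1\<close> is not in \<open>I\<close> makes the image of the
  constants a subfield.\<close>

lemma dim_quotient_eq_card_basis:
  fixes I :: "('n, 'k::field) mpol set" and v :: "'b \<Rightarrow> ('n, 'k) mpol"
  assumes I: "ideal I mpol_ring" and "1 \<notin> I" and "finite B"
    and indep: "\<And>c. (\<Sum>b\<in>B. mpol_const (c b) * v b) \<in> I \<Longrightarrow> \<forall>b\<in>B. c b = 0"
  shows "ring.dim (mpol_ring Quot I) (quot_scalars I)
           (range (\<lambda>c. I +>\<^bsub>mpol_ring\<^esub> (\<Sum>b\<in>B. mpol_const (c b) * v b))) = card B"
proof -
  let ?R = "mpol_ring :: ('n, 'k) mpol ring"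
  let ?\<phi> = "\<lambda>f. I +>\<^bsub>?R\<^esub> f"
  interpret I: ideal I ?R by (rule I)
  interpret hom: ring_hom_ring ?R "?R Quot I" ?\<phi> by (rule I.rcos_ring_hom_ring)
  note eq = coset_type_algebra_eq_iff[OF I]
  have K: "quot_scalars I = ?\<phi> ` range mpol_const" by (auto simp: quot_scalars_def)
  have add: "?\<phi> f \<oplus>\<^bsub>?R Quot I\<^esub> ?\<phi> g = ?\<phi> (f + g)" for f g
    using hom.hom_add[of f g] by simp
  have mult: "?\<phi> f \<otimes>\<^bsub>?R Quot I\<^esub> ?\<phi> g = ?\<phi> (f * g)" for f g
    using hom.hom_mult[of f g] by simp
  have zero: "\<zero>\<^bsub>?R Quot I\<^esub> = ?\<phi> 0" using hom.hom_zero by simp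
  have one: "\<one>\<^bsub>?R Quot I\<^esub> = ?\<phi> 1" using hom.hom_one by simp
  have "\<one>\<^bsub>?R Quot I\<^esub> \<noteq> \<zero>\<^bsub>?R Quot I\<^esub>"
    unfolding zero one using eq[of 1 0] \<open>1 \<notin> I\<close> by simp
  hence subf: "subfield (quot_scalars I) (?R Quot I)"
    unfolding K by (intro hom.img_is_subfield(2) subfield_mpol_const)
  have "hom.S.dimension (card B) (quot_scalars I)
      (range (\<lambda>c. ?\<phi> (\<Sum>b\<in>B. mpol_const (c b) * v b)))"
    using \<open>finite B\<close> indep
  proof (induction B rule: finite_induct)
    case empty
    have "range (\<lambda>c. ?\<phi> (\<Sum>b\<in>{}. mpol_const (c b) * v b)) = {\<zero>\<^bsub>?R Quot I\<^esub>}"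
      by (auto simp: zero)
    thus ?case using hom.S.dimension.zero_dim by simp
  next
    case (insert x B)
    let ?E = "range (\<lambda>c. ?\<phi> (\<Sum>b\<in>B. mpol_const (c b) * v b))"
    let ?E' = "range (\<lambda>c. ?\<phi> (\<Sum>b\<in>insert x B. mpol_const (c b) * v b))"
    have upd: "(\<Sum>b\<in>insert x B. mpol_const ((c(x := a)) b) * v b)
        = mpol_const a * v x + (\<Sum>b\<in>B. mpol_const (c b) * v b)" for c a
    proof -
      have "(\<Sum>b\<in>B. mpol_const ((c(x := a)) b) * v b) = (\<Sum>b\<in>B. mpol_const (c b) * v b)"
        using insert.hyps by (intro sum.cong) auto
      thus ?thesis using insert.hyps by simp
    qed
    have dimB: "hom.S.dimension (card B) (quot_scalars I) ?E"
    proof (rule insert.IH)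
      fix c assume "(\<Sum>b\<in>B. mpol_const (c b) * v b) \<in> I"
      hence "(\<Sum>b\<in>insert x B. mpol_const ((c(x := 0)) b) * v b) \<in> I"
        unfolding upd by simp
      from insert.prems[OF this] show "\<forall>b\<in>B. c b = 0"
        using insert.hyps by (auto split: if_splits)
    qed
    have "?\<phi> (v x) \<notin> ?E"
    proof
      assume "?\<phi> (v x) \<in> ?E"
      then obtain c where "v x - (\<Sum>b\<in>B. mpol_const (c b) * v b) \<in> I"
        using eq by auto
      \<comment> \<open>The coefficients are 1 at \<open>x\<close> and \<open>- c b\<close>
        elsewhere: a nontrivial relation modulo \<open>I\<close>.\<close>
      hence "(\<Sum>b\<in>insert x B. mpol_const (((\<lambda>b. - c b)(x := 1)) b) * v b) \<in> I"
        unfolding upd by (simp add: mpol_const_minus sum_negf)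
      from insert.prems[OF this] show False by auto
    qed
    moreover have "?\<phi> (v x) \<in> carrier (?R Quot I)" by (rule hom.hom_closed) simp
    ultimately have "hom.S.dimension (Suc (card B)) (quot_scalars I)
        (hom.S.line_extension (quot_scalars I) (?\<phi> (v x)) ?E)"
      using dimB by (intro hom.S.dimension.Suc_dim)
    moreover have "hom.S.line_extension (quot_scalars I) (?\<phi> (v x)) ?E = ?E'"
    proof (intro equalityI subsetI)
      fix u assume "u \<in> hom.S.line_extension (quot_scalars I) (?\<phi> (v x)) ?E"
      then obtain a c where "u = ?\<phi> (mpol_const a) \<otimes>\<^bsub>?R Quot I\<^esub> ?\<phi> (v x)
          \<oplus>\<^bsub>?R Quot I\<^esub> ?\<phi> (\<Sum>b\<in>B. mpol_const (c b) * v b)"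
        unfolding hom.S.line_extension_mem_iff K by auto
      hence "u = ?\<phi> (\<Sum>b\<in>insert x B. mpol_const ((c(x := a)) b) * v b)"
        unfolding upd by (simp only: add mult)
      thus "u \<in> ?E'" by blast
    next
      fix u assume "u \<in> ?E'"
      then obtain c where "u = ?\<phi> (\<Sum>b\<in>insert x B. mpol_const (c b) * v b)" by blast
      hence "u = ?\<phi> (mpol_const (c x)) \<otimes>\<^bsub>?R Quot I\<^esub> ?\<phi> (v x)
          \<oplus>\<^bsub>?R Quot I\<^esub> ?\<phi> (\<Sum>b\<in>B. mpol_const (c b) * v b)"
        using insert.hyps by (simp only: add mult sum.insert[OF insert.hyps])
      thus "u \<in> hom.S.line_extension (quot_scalars I) (?\<phi> (v x)) ?E"
        unfolding hom.S.line_extension_mem_iff K by blast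
    qed
    ultimately show ?case using insert.hyps by simp
  qed
  thus ?thesis
    using hom.S.dimI[OF subf] by (simp add: over_def)
qed

section \<open>The Frobenius power of the maximal ideal\<close>

text \<open>An ideal generated by monomials is spanned by the monomials it contains, so membership
  is decided exponent by exponent. One inclusion is minimality of the generated ideal, the other
  divides each monomial by a generator.\<close>

lemma frob_ideal_eq:
  "(frob_ideal N :: ('n::finite, 'k::comm_ring_1) mpol set)
     = {f. \<forall>u\<in>Poly_Mapping.keys f. \<exists>i. N \<le> Poly_Mapping.lookup u i}" (is "_ = ?J")
proof
  let ?R = "mpol_ring :: ('n, 'k) mpol ring"
  interpret R: ring ?R by (rule ring_from_type_algebra)
  have "ideal ?J ?R"
  proof (rule ideal_type_algebraI)
    fix f g :: "('n, 'k) mpol" assume "f \<in> ?J" "g \<in> ?J"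
    thus "f + g \<in> ?J" using Poly_Mapping.keys_add[of f g] by blast
  next
    fix f h :: "('n, 'k) mpol" assume f: "f \<in> ?J"
    show "h * f \<in> ?J"
    proof (intro CollectI ballI)
      fix u assume "u \<in> Poly_Mapping.keys (h * f)"
      then obtain a b where "u = a + b" "b \<in> Poly_Mapping.keys f"
        using keys_mult[of h f] by blast
      thus "\<exists>i. N \<le> Poly_Mapping.lookup u i"
        using f by (auto simp: lookup_add intro: trans_le_add2)
    qed
  qed simp
  moreover have "range (\<lambda>i. mpol_var i ^ N) \<subseteq> ?J"
    by (auto simp: mpol_var_power) (metis lookup_single_eq order_refl)
  ultimately show "frob_ideal N \<subseteq> ?J"
    unfolding frob_ideal_def by (rule R.genideal_minimal)
  show "?J \<subseteq> frob_ideal N"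
  proof
    fix f assume f: "f \<in> ?J"
    have gen: "ideal (frob_ideal N) ?R" "range (\<lambda>i. mpol_var i ^ N) \<subseteq> (frob_ideal N :: ('n, 'k) mpol set)"
      unfolding frob_ideal_def by (auto intro!: R.genideal_ideal R.genideal_self)
    have "Poly_Mapping.single u c \<in> frob_ideal N" if u: "N \<le> Poly_Mapping.lookup u i" for u and i :: 'n and c :: 'k
    proof -
      have "u = (u - Poly_Mapping.single i N) + Poly_Mapping.single i N"
        using u by (intro poly_mapping_eqI) (auto simp: lookup_add lookup_minus lookup_single when_def)
      hence "Poly_Mapping.single u c
          = Poly_Mapping.single (u - Poly_Mapping.single i N) c * mpol_var i ^ N"
        by (simp add: mpol_var_power mult_single)
      moreover have "Poly_Mapping.single (u - Poly_Mapping.single i N) c * mpol_var i ^ N \<in> frob_ideal N"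
        using gen(2) by (intro ideal_type_algebra_closed(3)[OF gen(1)]) blast
      ultimately show ?thesis by simp
    qed
    hence "(\<Sum>u\<in>Poly_Mapping.keys f. Poly_Mapping.single u (Poly_Mapping.lookup f u)) \<in> frob_ideal N"
      using f by (intro ideal_type_algebra_sum[OF gen(1)]) blast
    thus "f \<in> frob_ideal N" using poly_mapping_eq_sum_single[of "Poly_Mapping.keys f" f] by simp
  qed
qed

lemma ideal_frob_ideal: "ideal (frob_ideal N) (mpol_ring :: ('n, 'k::comm_ring_1) mpol ring)"
proof -
  interpret R: ring "mpol_ring :: ('n, 'k) mpol ring" by (rule ring_from_type_algebra)
  show ?thesis unfolding frob_ideal_def by (rule R.genideal_ideal) simp
qed

lemmas frob_ideal_closed = ideal_type_algebra_closed[OF ideal_frob_ideal]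

lemma mpol_var_power_in_frob_ideal:
  "mpol_var i ^ N \<in> (frob_ideal N :: ('n::finite, 'k::comm_ring_1) mpol set)"
  by (auto simp: frob_ideal_eq mpol_var_power intro: exI[of _ i])

text \<open>This makes coefficients visible in the quotient: polynomials congruent modulo the ideal
  agree at every exponent vector with all entries below \<open>N\<close>.\<close>

lemma lookup_eq_0_if_in_frob_ideal:
  fixes f :: "('n::finite, 'k::comm_ring_1) mpol"
  assumes "f \<in> frob_ideal N" "\<And>i. Poly_Mapping.lookup u i < N"
  shows "Poly_Mapping.lookup f u = 0"
proof (rule ccontr)
  assume "Poly_Mapping.lookup f u \<noteq> 0"
  then obtain i where "N \<le> Poly_Mapping.lookup u i"
    using assms(1) unfolding frob_ideal_eq by (auto simp flip: in_keys_iff)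
  thus False using assms(2)[of i] by simp
qed

text \<open>Each monomial of \<open>f\<close> has a factor \<open>x_i ^ N\<close>, which the
  substitution turns into \<open>a i ^ N\<close>.\<close>

lemma mpol_subst_frob_ideal:
  fixes f :: "('n::finite, 'k::comm_ring_1) mpol"
  assumes "\<And>i. a i ^ N \<in> frob_ideal N" "f \<in> frob_ideal N"
  shows "mpol_subst a f \<in> frob_ideal N"
proof -
  have "mpol_const (Poly_Mapping.lookup f u) * (\<Prod>i\<in>UNIV. a i ^ Poly_Mapping.lookup u i) \<in> frob_ideal N"
    if u: "u \<in> Poly_Mapping.keys f" for u
  proof -
    obtain i where "N \<le> Poly_Mapping.lookup u i" using u assms(2) by (auto simp: frob_ideal_eq)
    hence "a i ^ Poly_Mapping.lookup u i = a i ^ (Poly_Mapping.lookup u i - N) * a i ^ N"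
      by (simp flip: power_add)
    hence "a i ^ Poly_Mapping.lookup u i \<in> frob_ideal N"
      using assms(1) by (simp add: frob_ideal_closed)
    hence "(mpol_const (Poly_Mapping.lookup f u) * (\<Prod>j\<in>UNIV - {i}. a j ^ Poly_Mapping.lookup u j))
        * a i ^ Poly_Mapping.lookup u i \<in> frob_ideal N"
      by (rule frob_ideal_closed(3))
    thus ?thesis by (simp add: prod.remove[of UNIV i] mult_ac)
  qed
  thus ?thesis
    unfolding mpol_subst_def by (intro ideal_type_algebra_sum ideal_frob_ideal) 
qed

section \<open>Homogeneous polynomials\<close>

lemma homogeneous_mpols_0 [simp]: "0 \<in> homogeneous_mpols d"
  by (simp add: homogeneous_mpols_def)

lemma homogeneous_mpols_add:
  "f \<in> homogeneous_mpols d \<Longrightarrow> g \<in> homogeneous_mpols d \<Longrightarrow> f + g \<in> homogeneous_mpols d"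
  using Poly_Mapping.keys_add[of f g] by (auto simp: homogeneous_mpols_def)

lemma homogeneous_mpols_diff:
  "f \<in> homogeneous_mpols d \<Longrightarrow> g \<in> homogeneous_mpols d \<Longrightarrow> f - g \<in> homogeneous_mpols d"
  for f g :: "('n::finite, 'k::comm_ring_1) mpol"
  using homogeneous_mpols_add[of f d "- g"]
  by (simp add: homogeneous_mpols_def in_keys_iff)

lemma homogeneous_mpols_sum:
  "(\<And>x. x \<in> T \<Longrightarrow> g x \<in> homogeneous_mpols d) \<Longrightarrow> sum g T \<in> homogeneous_mpols d"
  by (induction T rule: infinite_finite_induct) (auto intro: homogeneous_mpols_add)

lemma homogeneous_mpols_mult:
  "f \<in> homogeneous_mpols d \<Longrightarrow> g \<in> homogeneous_mpols e \<Longrightarrow> f * g \<in> homogeneous_mpols (d + e)"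
  using keys_mult[of f g] by (fastforce simp: homogeneous_mpols_def lookup_add sum.distrib)

lemma homogeneous_mpols_single:
  "(\<Sum>i\<in>UNIV. Poly_Mapping.lookup u i) = d \<Longrightarrow> Poly_Mapping.single u c \<in> homogeneous_mpols d"
  by (auto simp: homogeneous_mpols_def)

lemma homogeneous_mpols_const: "mpol_const c \<in> homogeneous_mpols 0"
  by (auto simp: mpol_const_def intro: homogeneous_mpols_single)

lemma homogeneous_mpols_1: "(1 :: ('n::finite, 'k::comm_ring_1) mpol) \<in> homogeneous_mpols 0"
  by (metis homogeneous_mpols_const mpol_const_simps(2))

lemma homogeneous_mpols_const_mult:
  "f \<in> homogeneous_mpols d \<Longrightarrow> mpol_const c * f \<in> homogeneous_mpols d"
  using homogeneous_mpols_mult[OF homogeneous_mpols_const, of f d c] by simp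

lemma homogeneous_mpols_var: "mpol_var i \<in> homogeneous_mpols 1"
  unfolding mpol_var_def
  by (rule homogeneous_mpols_single) (simp add: lookup_single when_def)

lemma homogeneous_mpols_power:
  "f \<in> homogeneous_mpols d \<Longrightarrow> f ^ n \<in> homogeneous_mpols (n * d)"
  for f :: "('n::finite, 'k::comm_ring_1) mpol"
proof (induction n)
  case 0
  show ?case using homogeneous_mpols_1 by simp
next
  case (Suc n)
  thus ?case using homogeneous_mpols_mult[of f d "f ^ n" "n * d"] by simp
qed

lemma homogeneous_mpols_prod:
  fixes g :: "'a \<Rightarrow> ('n::finite, 'k::comm_ring_1) mpol"
  shows "(\<And>x. x \<in> T \<Longrightarrow> g x \<in> homogeneous_mpols (d x))
    \<Longrightarrow> prod g T \<in> homogeneous_mpols (sum d T)"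
proof (induction T rule: infinite_finite_induct)
  case (insert x T)
  thus ?case by (simp add: homogeneous_mpols_mult)
qed (simp_all add: homogeneous_mpols_1)

lemma homogeneous_mpols_subst:
  fixes f :: "('n::finite, 'k::comm_ring_1) mpol"
  assumes "\<And>i. a i \<in> homogeneous_mpols 1" "f \<in> homogeneous_mpols d"
  shows "mpol_subst a f \<in> homogeneous_mpols d"
  unfolding mpol_subst_def
proof (intro homogeneous_mpols_sum homogeneous_mpols_const_mult)
  fix u assume "u \<in> Poly_Mapping.keys f"
  hence "(\<Sum>i\<in>UNIV. Poly_Mapping.lookup u i) = d"
    using assms(2) by (auto simp: homogeneous_mpols_def)
  moreover have "(\<Prod>i\<in>UNIV. a i ^ Poly_Mapping.lookup u i)
      \<in> homogeneous_mpols (\<Sum>i\<in>UNIV. Poly_Mapping.lookup u i * 1)"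
    by (intro homogeneous_mpols_prod homogeneous_mpols_power assms)
  ultimately show "(\<Prod>i\<in>UNIV. a i ^ Poly_Mapping.lookup u i) \<in> homogeneous_mpols d" by simp
qed

section \<open>The action of the general linear group\<close>

definition linear_form :: "'k::comm_ring_1 ^ 'n ^ 'n \<Rightarrow> 'n::finite \<Rightarrow> ('n, 'k) mpol" where
  "linear_form A i = (\<Sum>j\<in>UNIV. mpol_const (A $ i $ j) * mpol_var j)"

lemma GL_act_eq: "GL_act g = mpol_subst (linear_form (matrix_inv g))"
  unfolding GL_act_def linear_form_def ..

lemma GL_act_hom [simp]:
  "GL_act g 0 = 0"
  "GL_act g (x + y) = GL_act g x + GL_act g y"
  "GL_act g (x - y) = GL_act g x - GL_act g y"
  "GL_act g (mpol_const c * x) = mpol_const c * GL_act g x"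
  by (simp_all add: GL_act_eq)

lemma GL_act_sum: "GL_act g (sum h T) = (\<Sum>x\<in>T. GL_act g (h x))"
  by (simp add: GL_act_eq mpol_subst_sum)

lemma matrix_inv_right: "invertible A \<Longrightarrow> A ** matrix_inv A = mat 1"
  and matrix_inv_left: "invertible A \<Longrightarrow> matrix_inv A ** A = mat 1"
  for A :: "'k::field ^ 'n ^ 'n"
  unfolding invertible_def matrix_inv_def by (metis (mono_tags, lifting) someI_ex)+

lemma matrix_inv_eqI: "B ** A = mat 1 \<Longrightarrow> matrix_inv A = B"
  for A B :: "'k::field ^ 'n ^ 'n"
  by (metis invertible_left_inverse matrix_inv_right matrix_mul_assoc matrix_mul_lid matrix_mul_rid)

lemma invertible_matrix_inv: "invertible A \<Longrightarrow> invertible (matrix_inv A)"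
  for A :: "'k::field ^ 'n ^ 'n"
  using invertible_right_inverse matrix_inv_left by blast

lemma matrix_inv_matrix_inv: "invertible A \<Longrightarrow> matrix_inv (matrix_inv A) = A"
  for A :: "'k::field ^ 'n ^ 'n"
  by (intro matrix_inv_eqI matrix_inv_right)

lemma matrix_inv_mult:
  "invertible A \<Longrightarrow> invertible B \<Longrightarrow> matrix_inv (A ** B) = matrix_inv B ** matrix_inv A"
  for A B :: "'k::field ^ 'n ^ 'n"
  by (rule matrix_inv_eqI) (metis matrix_inv_left matrix_mul_assoc matrix_mul_lid)

lemma linear_form_mat_1: "linear_form (mat 1) = mpol_var"
proof
  fix i
  have "linear_form (mat 1) i = (\<Sum>j\<in>UNIV. if j = i then mpol_var j else 0)"
    unfolding linear_form_def by (intro sum.cong) (auto simp: mat_def)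
  thus "linear_form (mat 1) i = mpol_var i" by simp
qed

text \<open>Substitution reverses the order of matrix products. The inverse in \<open>GL_act\<close>
  reverses it once more, which yields a left action in \<open>GL_act_mult\<close>.\<close>

lemma mpol_subst_linear_form: "mpol_subst (linear_form A) (linear_form B i) = linear_form (B ** A) i"
  by (simp add: linear_form_def mpol_subst_sum sum_distrib_left matrix_matrix_mult_def
      mpol_const_sum sum_distrib_right mult.assoc) (rule sum.swap)

lemma GL_act_mult:
  "invertible g \<Longrightarrow> invertible h \<Longrightarrow> GL_act (g ** h) f = GL_act g (GL_act h f)"
  by (simp add: GL_act_eq mpol_subst_subst mpol_subst_linear_form matrix_inv_mult)

lemma GL_act_mat_1 [simp]: "GL_act (mat 1) f = f"
  by (simp add: GL_act_eq matrix_inv_eqI linear_form_mat_1)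

lemma GL_act_matrix_inv:
  assumes "invertible g"
  shows "GL_act g (GL_act (matrix_inv g) f) = f" "GL_act (matrix_inv g) (GL_act g f) = f"
  using assms
  by (simp_all flip: GL_act_mult add: invertible_matrix_inv matrix_inv_left matrix_inv_right)

lemma homogeneous_mpols_GL_act:
  "f \<in> homogeneous_mpols d \<Longrightarrow> GL_act g f \<in> homogeneous_mpols d"
  unfolding GL_act_eq
  by (rule homogeneous_mpols_subst)
    (auto simp: linear_form_def simp del: One_nat_def intro!: homogeneous_mpols_sum
      homogeneous_mpols_const_mult homogeneous_mpols_var)

text \<open>By additivity of the Frobenius map, the \<open>Q\<close>-th power of a linear form is a
  combination of the \<open>Q\<close>-th powers of the variables. Hence the ideal is stable under
  linear substitutions.\<close>

lemma frob_ideal_subst_linear_form: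
  fixes f :: "('n::finite, 'k::{field,finite}) mpol"
  assumes "f \<in> frob_ideal (CARD('k) ^ m)"
  shows "mpol_subst (linear_form A) f \<in> frob_ideal (CARD('k) ^ m)"
proof (rule mpol_subst_frob_ideal[OF _ assms])
  fix i
  show "linear_form A i ^ (CARD('k) ^ m) \<in> (frob_ideal (CARD('k) ^ m) :: ('n, 'k) mpol set)"
    unfolding linear_form_def Frobenius_mpol_sum power_mult_distrib
    by (intro ideal_type_algebra_sum ideal_frob_ideal frob_ideal_closed(3)
        mpol_var_power_in_frob_ideal)
qed

lemma frob_ideal_GL_act:
  fixes f :: "('n::finite, 'k::{field,finite}) mpol"
  assumes "f \<in> frob_ideal (CARD('k) ^ m)"
  shows "GL_act g f \<in> frob_ideal (CARD('k) ^ m)"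
  unfolding GL_act_eq using assms by (rule frob_ideal_subst_linear_form)

section \<open>Invariants of the quotient\<close>

text \<open>For a stable ideal \<open>I\<close> this is the preimage in the polynomial ring of the
  invariants of the quotient; it allows work with representatives in place of cosets.\<close>

definition invariants_mod ::
  "('k::field ^ 'n ^ 'n) set \<Rightarrow> ('n::finite, 'k) mpol set \<Rightarrow> ('n, 'k) mpol set" where
  "invariants_mod G I = {f. \<forall>g\<in>G. GL_act g f - f \<in> I}"

lemma matrix_inv_in_GL_fixing: "g \<in> GL_fixing H \<Longrightarrow> matrix_inv g \<in> GL_fixing H"
  by (auto simp: GL_fixing_def invertible_matrix_inv)
    (metis matrix_inv_left matrix_vector_mul_assoc matrix_vector_mul_lid)

text \<open>Since \<open>I\<close> is stable, \<open>g\<close> maps the coset of an invariant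
  representative into itself. Invariance of cosets is an equality of sets, and the inverse of
  \<open>g\<close>, which also fixes \<open>H\<close>, supplies the other inclusion.\<close>

lemma quot_invariants_component:
  fixes H :: "('k::{field,finite} ^ 'n::finite) set" and m :: nat
  defines "I \<equiv> (frob_ideal (CARD('k) ^ m) :: ('n, 'k) mpol set)"
  shows "quot_invariants (GL_fixing H) I \<inter> quot_component I d
    = (\<lambda>f. I +>\<^bsub>mpol_ring\<^esub> f) ` (invariants_mod (GL_fixing H) I \<inter> homogeneous_mpols d)"
    (is "?L = ?R")
proof -
  have I: "ideal I mpol_ring" unfolding I_def by (rule ideal_frob_ideal)
  note closed = ideal_type_algebra_closed[OF I] and coset = coset_type_algebra[OF I]
  have act: "GL_act g f \<in> I" if "f \<in> I" for g f
    using that unfolding I_def by (rule frob_ideal_GL_act)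
  have into: "GL_act g h - f \<in> I"
    if f: "f \<in> invariants_mod (GL_fixing H) I" and g: "g \<in> GL_fixing H" and h: "h - f \<in> I" for f g h
  proof -
    have "(GL_act g h - GL_act g f) + (GL_act g f - f) \<in> I"
      using act[OF h, of g] f g by (intro closed(2)) (auto simp: invariants_mod_def)
    thus ?thesis by simp
  qed
  show ?thesis
  proof (intro equalityI subsetI)
    fix C assume C: "C \<in> ?L"
    then obtain f where f: "f \<in> homogeneous_mpols d" "C = I +>\<^bsub>mpol_ring\<^esub> f"
      by (auto simp: quot_component_def)
    have "GL_act g f - f \<in> I" if g: "g \<in> GL_fixing H" for g
    proof -
      have "f \<in> C" using f closed(1) by (simp add: coset)
      moreover have "GL_act g ` C = C" using C g by (simp add: quot_invariants_def)
      ultimately have "GL_act g f \<in> C" by blast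
      thus ?thesis using f by (simp add: coset)
    qed
    thus "C \<in> ?R" using f by (auto simp: invariants_mod_def)
  next
    fix C assume "C \<in> ?R"
    then obtain f where f: "f \<in> homogeneous_mpols d" "f \<in> invariants_mod (GL_fixing H) I"
      "C = I +>\<^bsub>mpol_ring\<^esub> f" by blast
    have "GL_act g ` C = C" if g: "g \<in> GL_fixing H" for g
    proof (intro equalityI subsetI)
      fix h assume "h \<in> GL_act g ` C"
      thus "h \<in> C" using into[OF f(2) g] f(3) by (auto simp: coset)
    next
      fix h assume "h \<in> C"
      \<comment> \<open>The preimage of \<open>h\<close> under \<open>g\<close> stays in the coset
        because \<open>matrix_inv g\<close> belongs to the same group.\<close>
      hence "GL_act (matrix_inv g) h \<in> C"
        using into[OF f(2) matrix_inv_in_GL_fixing[OF g]] f(3) by (simp add: coset)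
      moreover have "GL_act g (GL_act (matrix_inv g) h) = h"
        using g by (simp add: GL_fixing_def GL_act_matrix_inv)
      ultimately show "h \<in> GL_act g ` C" by (metis imageI)
    qed
    thus "C \<in> ?L"
      using f by (auto simp: quot_invariants_def quot_component_def carrier_Quot_type_algebra[OF I])
  qed
qed

section \<open>Reduction to a coordinate hyperplane\<close>

lemma GL_fixing_conjugate:
  fixes P :: "'k::field ^ 'n ^ 'n"
  assumes P: "invertible P" and H: "H = (*v) P ` H0" and g: "g \<in> GL_fixing H0"
  shows "P ** g ** matrix_inv P \<in> GL_fixing H"
proof -
  have "(P ** g ** matrix_inv P) *v (P *v v) = P *v v" if "v \<in> H0" for v
  proof -
    have "(P ** g ** matrix_inv P) *v (P *v v) = P *v (g *v ((matrix_inv P ** P) *v v))"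
      by (simp add: matrix_vector_mul_assoc matrix_mul_assoc)
    also have "\<dots> = P *v v" using g that P by (simp add: matrix_inv_left GL_fixing_def)
    finally show ?thesis .
  qed
  thus ?thesis using g P H
    by (auto simp: GL_fixing_def intro!: invertible_mult invertible_matrix_inv)
qed

text \<open>Conjugating \<open>g\<close> by \<open>P\<close> gives an element fixing
  \<open>H\<close>; invariance of \<open>GL_act P f\<close> under it is then pulled back along
  \<open>matrix_inv P\<close>, which preserves \<open>I\<close>.\<close>

lemma invariants_mod_conjugate:
  fixes H0 :: "('k::{field,finite} ^ 'n::finite) set" and m :: nat
  defines "I \<equiv> (frob_ideal (CARD('k) ^ m) :: ('n, 'k) mpol set)"
  assumes P: "invertible P" and H: "H = (*v) P ` H0"
    and f: "GL_act P f \<in> invariants_mod (GL_fixing H) I"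
  shows "f \<in> invariants_mod (GL_fixing H0) I"
  unfolding invariants_mod_def
proof (intro CollectI ballI)
  fix g assume g: "g \<in> GL_fixing H0"
  let ?g = "P ** g ** matrix_inv P"
  have invg: "invertible g" using g by (simp add: GL_fixing_def)
  have "GL_act ?g (GL_act P f) - GL_act P f \<in> I"
    using f GL_fixing_conjugate[OF P H g] by (auto simp: invariants_mod_def)
  hence "GL_act (matrix_inv P) (GL_act ?g (GL_act P f) - GL_act P f) \<in> I"
    unfolding I_def by (rule frob_ideal_GL_act)
  moreover have "GL_act ?g (GL_act P f) = GL_act P (GL_act g f)"
    using P invg by (simp add: GL_act_mult invertible_mult invertible_matrix_inv GL_act_matrix_inv)
  ultimately show "GL_act g f - f \<in> I" by (simp add: GL_act_matrix_inv P)
qed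

text \<open>A basis of \<open>H\<close> extends to the whole space by a single vector
  \<open>b\<close>. The matrix \<open>P\<close> has \<open>b\<close> as column \<open>i0\<close> and
  the basis of \<open>H\<close> as its other columns, so the coordinate at \<open>i0\<close>
  measures the component outside \<open>H\<close>.\<close>

lemma hyperplane_coordinates:
  fixes H :: "('k::field ^ 'n::finite) set" and i0 :: 'n
  assumes "is_hyperplane H"
  obtains P where "invertible P" "H = (*v) P ` {v. v $ i0 = 0}"
proof -
  have sub: "vec.subspace H" and dim: "vec.dim H = CARD('n) - 1"
    using assms by (auto simp: is_hyperplane_def)
  obtain B where B: "B \<subseteq> H" "vec.independent B" "H \<subseteq> vec.span B" "card B = vec.dim H"
    by (rule vec.basis_exists)
  have finB: "finite B" using B(2) by (rule vec.finiteI_independent)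
  have spanB: "vec.span B = H" using B sub by (metis subset_antisym vec.span_minimal)
  define B' where "B' = vec.extend_basis B"
  have B': "B \<subseteq> B'" "vec.independent B'" "vec.span B' = UNIV"
    unfolding B'_def using B(2) vec.extend_basis_superset vec.independent_extend_basis
      vec.span_extend_basis by auto
  have finB': "finite B'" using B'(2) by (rule vec.finiteI_independent)
  have "card B' = CARD('n)"
    using vec.dim_eq_card_independent[OF B'(2)] vec.dim_span[of B'] B'(3) by (simp add: vec.dim_UNIV card_cart_basis)
  hence "card (B' - B) = 1" using B B' dim finB by (simp add: card_Diff_subset)
  then obtain b where "B' - B = {b}" by (auto simp: card_1_singleton_iff)
  hence b: "B' = insert b B" "b \<notin> B" using B' by auto
  have "card (UNIV - {i0}) = card B" using B dim by simp
  then obtain \<sigma> where \<sigma>: "bij_betw \<sigma> (UNIV - {i0}) B"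
    using finite_same_card_bij[of "UNIV - {i0}" B] finB by auto
  define P :: "'k ^ 'n ^ 'n" where "P = (\<chi> i j. (if j = i0 then b else \<sigma> j) $ i)"
  have col: "column j P = (if j = i0 then b else \<sigma> j)" for j
    by (simp add: P_def column_def vec_eq_iff)
  have "columns P = insert b (\<sigma> ` (UNIV - {i0}))"
    by (auto simp: columns_def col)
  hence "vec.span (columns P) = UNIV" using \<sigma> b B'(3) by (simp add: bij_betw_def)
  hence P: "invertible P"
    by (simp add: invertible_right_inverse matrix_right_invertible_span_columns)
  have mv: "P *v v = v $ i0 *s b + (\<Sum>j\<in>UNIV - {i0}. v $ j *s \<sigma> j)" for v
    by (simp add: matrix_mult_sum sum.remove[of UNIV i0] col)
  have inH: "(\<Sum>j\<in>UNIV - {i0}. v $ j *s \<sigma> j) \<in> H" for v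
    using \<sigma> B(1) by (intro vec.subspace_sum[OF sub] vec.subspace_scale[OF sub]) (auto simp: bij_betw_def)
  have bH: "b \<notin> H"
    using B'(2) b spanB by (metis vec.independent_insert)
  have "H = (*v) P ` {v. v $ i0 = 0}"
  proof (intro equalityI subsetI)
    fix w assume w: "w \<in> H"
    define v where "v = matrix_inv P *v w"
    have Pv: "P *v v = w" by (simp add: v_def matrix_vector_mul_assoc matrix_inv_right P)
    \<comment> \<open>Were the coefficient of \<open>b\<close> nonzero, rescaling would put
      \<open>b\<close> itself into \<open>H\<close>.\<close>
    have "v $ i0 *s b \<in> H"
      using vec.subspace_diff[OF sub w inH[of v]] Pv mv[of v] by (metis add_diff_cancel_right')
    hence "v $ i0 = 0"
      using bH vec.subspace_scale[OF sub, of "v $ i0 *s b" "inverse (v $ i0)"]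
      by (cases "v $ i0 = 0") auto
    thus "w \<in> (*v) P ` {v. v $ i0 = 0}" using Pv by blast
  qed (auto simp: mv inH)
  thus thesis using P that by blast
qed

section \<open>Shears\<close>

text \<open>One family covers the whole stabilizer: for \<open>i\<close> other than
  \<open>i0\<close> the image is \<open>x_i + a_i z\<close>, while the entry \<open>a i0\<close> is
  the scaling factor of \<open>z\<close>. Transvections have \<open>a i0 = 1\<close>, pure scalings
  have all other entries 0.\<close>

definition shear :: "'n \<Rightarrow> ('n \<Rightarrow> 'k) \<Rightarrow> 'n \<Rightarrow> ('n, 'k::field) mpol" where
  "shear i0 a i = (if i = i0 then 0 else mpol_var i) + mpol_const (a i) * mpol_var i0"

text \<open>The identity matrix with column \<open>i0\<close> replaced by \<open>a\<close>.\<close>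

definition shear_matrix :: "'n \<Rightarrow> ('n \<Rightarrow> 'k) \<Rightarrow> 'k::field ^ 'n ^ 'n" where
  "shear_matrix i0 a = (\<chi> i j. if j = i0 then a i else if i = j then 1 else 0)"

lemma linear_form_shear_matrix: "linear_form (shear_matrix i0 a) = shear i0 a"
proof
  fix i
  have "(\<Sum>j\<in>UNIV - {i0}. mpol_const (shear_matrix i0 a $ i $ j) * mpol_var j)
     = (\<Sum>j\<in>UNIV - {i0}. if j = i then mpol_var j else 0)"
    by (intro sum.cong) (auto simp: shear_matrix_def)
  thus "linear_form (shear_matrix i0 a) i = shear i0 a i"
    by (simp add: linear_form_def sum.remove[of UNIV i0] shear_def shear_matrix_def sum.delta)
qed

lemma shear_matrix_mult_vector:
  "shear_matrix i0 a *v v = (\<chi> i. (if i = i0 then 0 else v $ i) + a i * v $ i0)"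
proof -
  have "(\<Sum>j\<in>UNIV - {i0}. shear_matrix i0 a $ i $ j * v $ j)
     = (\<Sum>j\<in>UNIV - {i0}. if j = i then v $ j else 0)" for i
    by (intro sum.cong) (auto simp: shear_matrix_def)
  thus ?thesis
    by (simp add: matrix_vector_mult_def vec_eq_iff sum.remove[of UNIV i0] sum.delta shear_matrix_def)
qed

lemma invertible_shear_matrix:
  assumes "a i0 \<noteq> 0"
  shows "invertible (shear_matrix i0 a)"
proof -
  have "inj ((*v) (shear_matrix i0 a))"
  proof (rule injI)
    fix v w assume eq: "shear_matrix i0 a *v v = shear_matrix i0 a *v w"
    hence *: "(if i = i0 then 0 else v $ i) + a i * v $ i0 = (if i = i0 then 0 else w $ i) + a i * w $ i0" for i
      by (simp add: shear_matrix_mult_vector vec_eq_iff)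
    have i0: "v $ i0 = w $ i0" using *[of i0] assms by simp
    have "v $ i = w $ i" for i using *[of i] i0 by (cases "i = i0") simp_all
    thus "v = w" by (simp add: vec_eq_iff)
  qed
  thus ?thesis by (simp add: invertible_left_inverse matrix_left_invertible_injective)
qed

lemma shear_matrix_in_GL_fixing:
  "a i0 \<noteq> 0 \<Longrightarrow> shear_matrix i0 a \<in> GL_fixing {v. v $ i0 = 0}"
  by (auto simp: GL_fixing_def invertible_shear_matrix shear_matrix_mult_vector vec_eq_iff)

text \<open>The standard basis vectors other than the one at \<open>i0\<close> are fixed, which
  determines all columns but one.\<close>

lemma GL_fixing_coordinate_hyperplane:
  assumes g: "g \<in> GL_fixing {v. v $ i0 = 0}"
  obtains a where "a i0 \<noteq> 0" "g = shear_matrix i0 a"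
proof -
  define a where "a i = g $ i $ i0" for i
  have "g $ i $ j = (if i = j then 1 else 0)" if "j \<noteq> i0" for i j
  proof -
    have "g *v axis j 1 = axis j 1" using g that by (auto simp: GL_fixing_def axis_def)
    moreover have "(\<Sum>k\<in>UNIV. g $ i $ k * axis j 1 $ k) = (\<Sum>k\<in>UNIV. if k = j then g $ i $ k else 0)"
      by (intro sum.cong) (auto simp: axis_def)
    hence "(g *v axis j 1) $ i = g $ i $ j" by (simp add: matrix_vector_mult_def)
    ultimately show ?thesis by (auto simp: axis_def)
  qed
  hence eq: "g = shear_matrix i0 a" by (auto simp: shear_matrix_def a_def vec_eq_iff)
  have "a i0 \<noteq> 0"
  proof
    assume "a i0 = 0"
    \<comment> \<open>If \<open>a i0\<close> were 0, this nonzero vector would lie in the kernel of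
      \<open>g\<close>.\<close>
    define v :: "'a ^ 'b" where "v = (\<chi> i. if i = i0 then 1 else - a i)"
    have "g *v v = g *v 0"
      using \<open>a i0 = 0\<close> by (simp add: eq shear_matrix_mult_vector v_def vec_eq_iff)
    moreover have "inj ((*v) g)"
      using g by (intro inj_matrix_vector_mult) (simp add: GL_fixing_def)
    ultimately have "v = 0" by (rule injD[rotated])
    hence "v $ i0 = 0" by simp
    thus False by (simp add: v_def)
  qed
  thus thesis using eq that by blast
qed

text \<open>The action substitutes the inverse matrix, but the stabilizer is closed under inverses,
  so it is the same to test all shears directly.\<close>

lemma invariants_mod_coordinate_hyperplane:
  "f \<in> invariants_mod (GL_fixing {v. v $ i0 = 0}) I
     \<longleftrightarrow> (\<forall>a. a i0 \<noteq> 0 \<longrightarrow> mpol_subst (shear i0 a) f - f \<in> I)"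
proof
  assume f: "f \<in> invariants_mod (GL_fixing {v. v $ i0 = 0}) I"
  show "\<forall>a. a i0 \<noteq> 0 \<longrightarrow> mpol_subst (shear i0 a) f - f \<in> I"
  proof (intro allI impI)
    fix a :: "'a \<Rightarrow> 'b" assume a: "a i0 \<noteq> 0"
    have "GL_act (matrix_inv (shear_matrix i0 a)) f - f \<in> I"
      using f shear_matrix_in_GL_fixing[of a i0, OF a] matrix_inv_in_GL_fixing
      by (auto simp: invariants_mod_def)
    thus "mpol_subst (shear i0 a) f - f \<in> I"
      by (simp add: GL_act_eq matrix_inv_matrix_inv invertible_shear_matrix a linear_form_shear_matrix)
  qed
next
  assume f: "\<forall>a. a i0 \<noteq> 0 \<longrightarrow> mpol_subst (shear i0 a) f - f \<in> I"
  show "f \<in> invariants_mod (GL_fixing {v. v $ i0 = 0}) I"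
    unfolding invariants_mod_def
  proof (intro CollectI ballI)
    fix g :: "'b ^ 'a ^ 'a" assume "g \<in> GL_fixing {v. v $ i0 = 0}"
    from matrix_inv_in_GL_fixing[OF this] obtain a where "a i0 \<noteq> 0" "matrix_inv g = shear_matrix i0 a"
      by (rule GL_fixing_coordinate_hyperplane)
    thus "GL_act g f - f \<in> I" using f by (simp add: GL_act_eq linear_form_shear_matrix)
  qed
qed

section \<open>Leading terms with respect to the distinguished variable\<close>

text \<open>A lower bound for the \<open>z\<close>-adic order, with \<open>z\<close> the variable
  \<open>i0\<close>; stated as a bound, it covers the zero polynomial.\<close>

definition order_ge :: "'n \<Rightarrow> nat \<Rightarrow> ('n, 'k::zero) mpol \<Rightarrow> bool" where
  "order_ge i0 j f \<longleftrightarrow> (\<forall>w\<in>Poly_Mapping.keys f. j \<le> Poly_Mapping.lookup w i0)"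

lemma order_ge_0 [simp]: "order_ge i0 j 0"
  by (simp add: order_ge_def)

lemma order_ge_mono: "order_ge i0 j f \<Longrightarrow> k \<le> j \<Longrightarrow> order_ge i0 k f"
  by (auto simp: order_ge_def intro: order_trans)

lemma order_ge_single: "j \<le> Poly_Mapping.lookup u i0 \<Longrightarrow> order_ge i0 j (Poly_Mapping.single u c)"
  by (auto simp: order_ge_def)

lemma order_ge_add: "order_ge i0 j f \<Longrightarrow> order_ge i0 j g \<Longrightarrow> order_ge i0 j (f + g)"
  using Poly_Mapping.keys_add[of f g] by (auto simp: order_ge_def)

lemma order_ge_mult: "order_ge i0 j f \<Longrightarrow> order_ge i0 k g \<Longrightarrow> order_ge i0 (j + k) (f * g)"
  using keys_mult[of f g] by (fastforce simp: order_ge_def lookup_add intro: add_mono)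

text \<open>Leading means of lowest order in \<open>z\<close>: \<open>f\<close> is the monic
  monomial with exponent \<open>u\<close> plus terms of strictly higher order, so no second monomial
  shares the lowest order.\<close>

definition has_lead :: "'n \<Rightarrow> ('n \<Rightarrow>\<^sub>0 nat) \<Rightarrow> ('n, 'k::comm_ring_1) mpol \<Rightarrow> bool" where
  "has_lead i0 u f \<longleftrightarrow> order_ge i0 (Suc (Poly_Mapping.lookup u i0)) (f - Poly_Mapping.single u 1)"

lemma has_lead_single: "has_lead i0 u (Poly_Mapping.single u 1)"
  by (simp add: has_lead_def)

text \<open>Split each factor into its lead and a remainder; all three products that involve a
  remainder have order above the sum of the two leading orders.\<close>

lemma has_lead_mult:
  assumes "has_lead i0 u f" "has_lead i0 v g"
  shows "has_lead i0 (u + v) (f * g)"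
proof -
  let ?x = "Poly_Mapping.single u 1" and ?y = "Poly_Mapping.single v 1"
  let ?j = "Poly_Mapping.lookup u i0" and ?k = "Poly_Mapping.lookup v i0"
  have f: "order_ge i0 (Suc ?j) (f - ?x)" and g: "order_ge i0 (Suc ?k) (g - ?y)"
    using assms by (auto simp: has_lead_def)
  have "order_ge i0 (?j + Suc ?k) (?x * (g - ?y))" "order_ge i0 (Suc ?j + ?k) ((f - ?x) * ?y)"
    "order_ge i0 (Suc ?j + Suc ?k) ((f - ?x) * (g - ?y))"
    by (intro order_ge_mult f g order_ge_single order_refl)+
  hence "order_ge i0 (Suc (?j + ?k)) (?x * (g - ?y) + (f - ?x) * ?y + (f - ?x) * (g - ?y))"
    by (intro order_ge_add) (auto elim: order_ge_mono)
  moreover have "?x * (g - ?y) + (f - ?x) * ?y + (f - ?x) * (g - ?y)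
      = f * g - Poly_Mapping.single (u + v) 1"
    by (simp add: algebra_simps mult_single)
  ultimately show ?thesis by (simp add: has_lead_def lookup_add)
qed

lemma has_lead_1: "has_lead i0 0 1"
  using has_lead_single[of i0 0] by simp

lemma has_lead_power:
  "has_lead i0 u f \<Longrightarrow> has_lead i0 (\<Sum>_<n. u) (f ^ n)"
  by (induction n) (simp_all add: has_lead_1 has_lead_mult add.commute mult.commute)

lemma has_lead_prod:
  "(\<And>x. x \<in> T \<Longrightarrow> has_lead i0 (u x) (f x)) \<Longrightarrow> has_lead i0 (sum u T) (prod f T)"
  by (induction T rule: infinite_finite_induct) (simp_all add: has_lead_1 has_lead_mult)

text \<open>The triangularity behind both independence and spanning: up to its leading order, such a
  polynomial has just one coefficient.\<close>

lemma lookup_has_lead: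
  assumes "has_lead i0 u f" "Poly_Mapping.lookup w i0 \<le> Poly_Mapping.lookup u i0"
  shows "Poly_Mapping.lookup f w = (if w = u then 1 else 0)"
proof -
  have "w \<notin> Poly_Mapping.keys (f - Poly_Mapping.single u 1)"
    using assms by (auto simp: has_lead_def order_ge_def)
  thus ?thesis by (simp add: in_keys_iff lookup_minus lookup_single when_def)
qed

section \<open>The basis of invariants\<close>

text \<open>Leading exponents of the basis of invariants. The \<open>itself\<close> argument
  supplies \<open>q\<close>, which the type of exponent vectors does not determine.\<close>

definition inv_exponents :: "'k::{field,finite} itself \<Rightarrow> 'n::finite \<Rightarrow> nat \<Rightarrow> ('n \<Rightarrow>\<^sub>0 nat) set" where
  "inv_exponents _ i0 m = {u. (\<forall>i. Poly_Mapping.lookup u i < CARD('k) ^ m) \<and>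
     (Poly_Mapping.lookup u i0 = CARD('k) ^ m - 1 \<or>
      (CARD('k) - 1) dvd Poly_Mapping.lookup u i0 \<and>
      (\<forall>i. i \<noteq> i0 \<longrightarrow> CARD('k) dvd Poly_Mapping.lookup u i))}"

text \<open>The orbit product of \<open>x\<^sub>i\<close> under the shears \<open>x\<^sub>i \<mapsto> x\<^sub>i + c z\<close>, where \<open>z\<close> is the
  distinguished variable.\<close>

definition orbit_norm :: "'n \<Rightarrow> 'n \<Rightarrow> ('n, 'k::{field,finite}) mpol" where
  "orbit_norm i0 i = mpol_var i ^ CARD('k) - mpol_var i * mpol_var i0 ^ (CARD('k) - 1)"

text \<open>With \<open>z\<close>-exponent \<open>Q - 1\<close> a plain monomial is already
  invariant modulo the ideal, since one more factor \<open>z\<close> gives \<open>z ^ Q\<close>. In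
  the other case the division by \<open>q\<close> is exact on \<open>inv_exponents\<close>, so the
  lead has exponent \<open>u\<close>.\<close>

definition inv_basis :: "'n::finite \<Rightarrow> nat \<Rightarrow> ('n \<Rightarrow>\<^sub>0 nat) \<Rightarrow> ('n, 'k::{field,finite}) mpol" where
  "inv_basis i0 m u =
     (if Poly_Mapping.lookup u i0 = CARD('k) ^ m - 1 then Poly_Mapping.single u 1
      else mpol_var i0 ^ Poly_Mapping.lookup u i0 *
        (\<Prod>i\<in>UNIV - {i0}. orbit_norm i0 i ^ (Poly_Mapping.lookup u i div CARD('k))))"

lemma finite_inv_exponents: "finite (inv_exponents TYPE('k::{field,finite}) (i0::'n::finite) m)"
proof -
  have "Poly_Mapping.lookup ` inv_exponents TYPE('k) i0 m \<subseteq> (UNIV :: 'n set) \<rightarrow>\<^sub>E {..<CARD('k) ^ m}"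
    by (force simp: inv_exponents_def)
  moreover have "finite ((UNIV :: 'n set) \<rightarrow>\<^sub>E {..<CARD('k) ^ m})" by (intro finite_PiE) simp_all
  ultimately have "finite (Poly_Mapping.lookup ` inv_exponents TYPE('k) i0 m)" by (rule finite_subset)
  thus ?thesis
    by (rule finite_imageD) (rule inj_onI, rule poly_mapping_eqI, simp)
qed

text \<open>The term subtracted from \<open>x_i ^ q\<close> carries \<open>z ^ (q - 1)\<close>, of
  positive order because \<open>q\<close> is at least 2, while \<open>x_i ^ q\<close> has order
  0.\<close>

lemma has_lead_orbit_norm:
  assumes "i \<noteq> i0"
  shows "has_lead i0 (Poly_Mapping.single i CARD('k)) (orbit_norm i0 i :: ('n, 'k::{field,finite}) mpol)"
proof -
  have "orbit_norm i0 i - Poly_Mapping.single (Poly_Mapping.single i CARD('k)) 1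
      = (Poly_Mapping.single (Poly_Mapping.single i 1 + Poly_Mapping.single i0 (CARD('k) - 1)) (- 1)
          :: ('n, 'k) mpol)"
    by (simp add: orbit_norm_def mpol_var_power single_uminus)
       (simp add: mpol_var_def mult_single)
  thus ?thesis
    using assms card_field_ge_2[where 'k = 'k]
    by (auto simp: has_lead_def order_ge_def lookup_add lookup_single)
qed

lemma has_lead_inv_basis:
  assumes u: "u \<in> inv_exponents TYPE('k) i0 m"
  shows "has_lead i0 u (inv_basis i0 m u :: ('n::finite, 'k::{field,finite}) mpol)"
proof (cases "Poly_Mapping.lookup u i0 = CARD('k) ^ m - 1")
  case True
  thus ?thesis by (simp add: inv_basis_def has_lead_single)
next
  case False
  let ?q = "CARD('k)"
  let ?e = "Poly_Mapping.single i0 (Poly_Mapping.lookup u i0)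
    + (\<Sum>i\<in>UNIV - {i0}. \<Sum>_<Poly_Mapping.lookup u i div ?q. Poly_Mapping.single i ?q)"
  have "has_lead i0 ?e (inv_basis i0 m u :: ('n, 'k) mpol)"
    unfolding inv_basis_def if_not_P[OF False] mpol_var_power
    by (rule has_lead_mult[OF has_lead_single], rule has_lead_prod, rule has_lead_power,
        rule has_lead_orbit_norm) simp
  \<comment> \<open>Divisibility of the remaining entries by \<open>q\<close> makes
    \<open>div\<close> followed by multiplication the identity.\<close>
  moreover have "?e = u"
  proof -
    have "(\<Sum>_<n. Poly_Mapping.single i k) = Poly_Mapping.single i (n * k)" for n k :: nat and i :: 'n
      by (induction n) (simp_all add: add.commute flip: single_add)
    hence "?e = Poly_Mapping.single i0 (Poly_Mapping.lookup u i0)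
        + (\<Sum>i\<in>UNIV - {i0}. Poly_Mapping.single i (Poly_Mapping.lookup u i))"
      using u False by (simp add: inv_exponents_def)
    also have "\<dots> = (\<Sum>i\<in>UNIV. Poly_Mapping.single i (Poly_Mapping.lookup u i))"
      by (simp add: sum.remove[of UNIV i0])
    finally show ?thesis by (simp add: sum_single_lookup)
  qed
  ultimately show ?thesis by simp
qed

lemma homogeneous_inv_basis:
  assumes u: "u \<in> inv_exponents TYPE('k) i0 m"
  shows "(inv_basis i0 m u :: ('n::finite, 'k::{field,finite}) mpol)
    \<in> homogeneous_mpols (\<Sum>i\<in>UNIV. Poly_Mapping.lookup u i)"
proof (cases "Poly_Mapping.lookup u i0 = CARD('k) ^ m - 1")
  case True
  thus ?thesis by (simp add: inv_basis_def homogeneous_mpols_single)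
next
  case False
  let ?q = "CARD('k)"
  have q: "?q \<ge> 2" by (rule card_field_ge_2)
  have norm: "(orbit_norm i0 i :: ('n, 'k) mpol) \<in> homogeneous_mpols ?q" for i
  proof -
    have "(mpol_var i ^ ?q :: ('n, 'k) mpol) \<in> homogeneous_mpols (?q * 1)"
      "(mpol_var i * mpol_var i0 ^ (?q - 1) :: ('n, 'k) mpol) \<in> homogeneous_mpols (1 + (?q - 1) * 1)"
      by (intro homogeneous_mpols_mult homogeneous_mpols_power homogeneous_mpols_var)+
    moreover have "1 + (?q - 1) * 1 = ?q" using q by simp
    ultimately show ?thesis unfolding orbit_norm_def by (simp add: homogeneous_mpols_diff)
  qed
  have "(inv_basis i0 m u :: ('n, 'k) mpol) \<in> homogeneous_mpols
     (Poly_Mapping.lookup u i0 * 1 + (\<Sum>i\<in>UNIV - {i0}. Poly_Mapping.lookup u i div ?q * ?q))"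
    unfolding inv_basis_def if_not_P[OF False]
    by (intro homogeneous_mpols_mult homogeneous_mpols_prod homogeneous_mpols_power
        homogeneous_mpols_var norm)
  also have "(\<Sum>i\<in>UNIV - {i0}. Poly_Mapping.lookup u i div ?q * ?q)
      = (\<Sum>i\<in>UNIV - {i0}. Poly_Mapping.lookup u i)"
    using u False by (intro sum.cong) (auto simp: inv_exponents_def)
  finally show ?thesis by (simp add: sum.remove[of UNIV i0])
qed

text \<open>The power \<open>x_i ^ q\<close> gains \<open>a_i ^ q * z ^ q\<close>, which is
  \<open>a_i * z ^ q\<close>. The product \<open>x_i * z ^ (q - 1)\<close> gains the same term,
  because \<open>a i0 ^ (q - 1) = 1\<close>. The two cancel, so the invariance is exact, not only
  modulo the ideal.\<close>

lemma orbit_norm_shear: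
  fixes a :: "'n::finite \<Rightarrow> 'k::{field,finite}"
  assumes "a i0 \<noteq> 0" "i \<noteq> i0"
  shows "mpol_subst (shear i0 a) (orbit_norm i0 i) = (orbit_norm i0 i :: ('n, 'k) mpol)"
proof -
  let ?q = "CARD('k)"
  let ?z = "mpol_var i0 :: ('n, 'k) mpol" and ?x = "mpol_var i :: ('n, 'k) mpol"
  have "?z * ?z ^ (?q - 1) = ?z ^ ?q"
    using card_field_ge_2[where 'k = 'k] by (simp flip: power_Suc)
  moreover have "mpol_const (a i0) ^ (?q - 1) = (1 :: ('n, 'k) mpol)"
    using finite_field_power_card_minus_1[OF assms(1)] by (simp flip: mpol_const_power)
  moreover have "mpol_const (a i) ^ ?q = (mpol_const (a i) :: ('n, 'k) mpol)"
    by (simp add: finite_field_power_card flip: mpol_const_power)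
  ultimately show ?thesis
    using assms(2)
    by (simp add: orbit_norm_def shear_def Frobenius_mpol_add power_mult_distrib distrib_right mult.assoc)
qed

lemma dvd_power_diff_if_dvd_diff:
  "d dvd x - y \<Longrightarrow> d dvd x ^ n - y ^ n" for d x y :: "'a::comm_ring_1"
  by (metis dvd_mult2 power_diff_sumr2)

lemma dvd_prod_diff_if_dvd_diff:
  fixes d :: "'a::comm_ring_1"
  shows "(\<And>x. x \<in> T \<Longrightarrow> d dvd f x - g x) \<Longrightarrow> d dvd prod f T - prod g T"
proof (induction T rule: infinite_finite_induct)
  case (insert x T)
  have "prod f (insert x T) - prod g (insert x T)
      = f x * (prod f T - prod g T) + (f x - g x) * prod g T"
    using insert by (simp add: algebra_simps)
  thus ?case using insert by (simp add: dvd_add)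
qed simp_all

text \<open>Products of orbit norms and a power of \<open>z\<close> with exponent divisible by
  \<open>q - 1\<close> are fixed exactly. For \<open>z\<close>-exponent \<open>Q - 1\<close>, a
  shear changes the other factors by a multiple of \<open>z\<close>, and the resulting error is a
  multiple of \<open>z ^ Q\<close>.\<close>

lemma inv_basis_shear:
  fixes a :: "'n::finite \<Rightarrow> 'k::{field,finite}"
  assumes u: "u \<in> inv_exponents TYPE('k) i0 m" and a: "a i0 \<noteq> 0"
  shows "mpol_subst (shear i0 a) (inv_basis i0 m u) - inv_basis i0 m u
    \<in> (frob_ideal (CARD('k) ^ m) :: ('n, 'k) mpol set)"
proof (cases "Poly_Mapping.lookup u i0 = CARD('k) ^ m - 1")
  case False
  let ?q = "CARD('k)"
  obtain k where k: "Poly_Mapping.lookup u i0 = (?q - 1) * k"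
    using u False by (auto simp: inv_exponents_def elim!: dvdE)
  have "mpol_const (a i0) ^ Poly_Mapping.lookup u i0 = (1 :: ('n, 'k) mpol)"
    unfolding k power_mult
    using finite_field_power_card_minus_1[OF a] by (simp flip: mpol_const_power)
  hence "mpol_subst (shear i0 a) (inv_basis i0 m u) = (inv_basis i0 m u :: ('n, 'k) mpol)"
    using False
    by (auto simp: inv_basis_def mpol_subst_prod orbit_norm_shear[of a, OF a] shear_def[of _ _ i0]
        power_mult_distrib intro!: prod.cong)
  thus ?thesis by (simp add: frob_ideal_closed)
next
  case True
  let ?Q = "CARD('k) ^ m"
  let ?z = "mpol_var i0 :: ('n, 'k) mpol"
  let ?y = "\<Prod>i\<in>UNIV - {i0}. mpol_var i ^ Poly_Mapping.lookup u i :: ('n, 'k) mpol"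
  let ?y' = "\<Prod>i\<in>UNIV - {i0}. shear i0 a i ^ Poly_Mapping.lookup u i :: ('n, 'k) mpol"
  have Q: "?Q \<ge> 1" using card_field_ge_2[where 'k = 'k] by simp
  have basis: "inv_basis i0 m u = ?z ^ (?Q - 1) * ?y"
    using True prod_mpol_var_power[of u, where 'k = 'k]
    by (simp add: inv_basis_def prod.remove[of UNIV i0])
  have "a i0 * a i0 ^ (?Q - 1) = a i0"
    using Q finite_field_power_card_power[of "a i0" m] by (simp flip: power_Suc)
  hence "a i0 ^ (?Q - 1) = 1" using a by simp
  hence "mpol_const (a i0) ^ (?Q - 1) = (1 :: ('n, 'k) mpol)"
    by (simp flip: mpol_const_power)
  hence "mpol_subst (shear i0 a) (inv_basis i0 m u) = ?z ^ (?Q - 1) * ?y'"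
    by (simp add: basis mpol_subst_prod shear_def[of _ _ i0] power_mult_distrib)
  \<comment> \<open>Each substituted variable differs from the original by a multiple of
    \<open>z\<close>, and congruence modulo \<open>z\<close> passes to powers and products.\<close>
  moreover have "?z dvd ?y' - ?y"
    by (intro dvd_prod_diff_if_dvd_diff dvd_power_diff_if_dvd_diff) (auto simp: shear_def)
  then obtain h where "?y' - ?y = ?z * h" by blast
  hence "?z ^ (?Q - 1) * (?y' - ?y) = h * (?z * ?z ^ (?Q - 1))" by (simp add: mult_ac)
  ultimately have "mpol_subst (shear i0 a) (inv_basis i0 m u) - inv_basis i0 m u = h * (?z * ?z ^ (?Q - 1))"
    by (simp only: basis right_diff_distrib)
  also have "?z * ?z ^ (?Q - 1) = ?z ^ ?Q" using Q by (simp flip: power_Suc)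
  finally show ?thesis by (simp add: frob_ideal_closed mpol_var_power_in_frob_ideal)
qed

text \<open>Among the exponents with nonzero coefficient take \<open>u\<close> of least order in
  \<open>z\<close>. No other lead interferes at \<open>u\<close>, so the sum has coefficient
  \<open>c u\<close> there; all entries of \<open>u\<close> are below \<open>Q\<close>, so
  membership in the ideal makes it 0.\<close>

lemma inv_basis_independent:
  fixes c :: "('n::finite \<Rightarrow>\<^sub>0 nat) \<Rightarrow> 'k::{field,finite}"
  assumes B: "B \<subseteq> inv_exponents TYPE('k) i0 m"
    and sum: "(\<Sum>u\<in>B. mpol_const (c u) * inv_basis i0 m u) \<in> frob_ideal (CARD('k) ^ m)"
  shows "\<forall>u\<in>B. c u = 0"
proof (rule ccontr)
  assume "\<not> (\<forall>u\<in>B. c u = 0)"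
  hence ex: "\<exists>u. u \<in> B \<and> c u \<noteq> 0" by blast
  obtain u where u: "u \<in> B" "c u \<noteq> 0"
    and min: "\<And>w. w \<in> B \<Longrightarrow> c w \<noteq> 0 \<Longrightarrow> Poly_Mapping.lookup u i0 \<le> Poly_Mapping.lookup w i0"
    using ex_has_least_nat[of "\<lambda>u. u \<in> B \<and> c u \<noteq> 0" _ "\<lambda>u. Poly_Mapping.lookup u i0"] ex
    by blast
  have "Poly_Mapping.lookup (\<Sum>u\<in>B. mpol_const (c u) * inv_basis i0 m u) u
      = (\<Sum>w\<in>B. if w = u then c w else 0)"
    unfolding lookup_sum lookup_const_mult
  proof (rule sum.cong[OF refl])
    fix w assume w: "w \<in> B"
    show "c w * Poly_Mapping.lookup (inv_basis i0 m w) u = (if w = u then c w else 0)"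
      using lookup_has_lead[OF has_lead_inv_basis[where 'k = 'k], of w i0 m u] min[OF w] w B
      by (cases "c w = 0") auto
  qed
  also have "\<dots> = c u"
    using u(1) finite_subset[OF B finite_inv_exponents] by simp
  finally have "c u = 0"
    using lookup_eq_0_if_in_frob_ideal[OF sum, of u] u(1) B by (auto simp: inv_exponents_def)
  thus False using u by simp
qed

section \<open>Leading exponents of invariants\<close>

lemma lookup_mpol_subst:
  "Poly_Mapping.lookup (mpol_subst a f) t
     = (\<Sum>w\<in>Poly_Mapping.keys f. Poly_Mapping.lookup f w *
          Poly_Mapping.lookup (\<Prod>i\<in>UNIV. a i ^ Poly_Mapping.lookup w i) t)"
  by (simp add: mpol_subst_def lookup_sum)

lemma prod_shear_scaling:
  fixes b :: "'k::field" and i0 :: "'n::finite"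
  shows "(\<Prod>i\<in>UNIV. shear i0 (\<lambda>i. if i = i0 then b else 0) i ^ Poly_Mapping.lookup w i)
     = Poly_Mapping.single w (b ^ Poly_Mapping.lookup w i0)"
proof -
  let ?s = "shear i0 (\<lambda>i. if i = i0 then b else 0)"
  have "(\<Prod>i\<in>UNIV - {i0}. ?s i ^ Poly_Mapping.lookup w i)
      = (\<Prod>i\<in>UNIV - {i0}. mpol_var i ^ Poly_Mapping.lookup w i)"
    by (intro prod.cong) (auto simp: shear_def)
  hence "(\<Prod>i\<in>UNIV. ?s i ^ Poly_Mapping.lookup w i)
      = mpol_const (b ^ Poly_Mapping.lookup w i0) * (\<Prod>i\<in>UNIV. mpol_var i ^ Poly_Mapping.lookup w i)"
    by (simp add: prod.remove[of UNIV i0] shear_def power_mult_distrib mpol_const_power mult.assoc)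
  thus ?thesis by (simp add: prod_mpol_var_power mpol_const_mult_single)
qed

text \<open>In the expansion of a power of \<open>x_i + c z\<close>, choosing \<open>c z\<close>
  from \<open>e\<close> of the factors moves \<open>e\<close> units of exponent from
  \<open>i\<close> to \<open>i0\<close>.\<close>

lemma prod_shear_transvection:
  fixes c :: "'k::field" and i0 i :: "'n::finite"
  assumes "i \<noteq> i0"
  shows "(\<Prod>k\<in>UNIV. shear i0 (\<lambda>k. if k = i0 then 1 else if k = i then c else 0) k ^ Poly_Mapping.lookup w k)
     = (\<Sum>e\<le>Poly_Mapping.lookup w i. Poly_Mapping.single
          (w - Poly_Mapping.single i e + Poly_Mapping.single i0 e)
          (of_nat (Poly_Mapping.lookup w i choose e) * c ^ e))"
proof -
  let ?s = "shear i0 (\<lambda>k. if k = i0 then 1 else if k = i then c else 0)"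
  let ?n = "Poly_Mapping.lookup w i"
  let ?x = "mpol_var i :: ('n, 'k) mpol" and ?z = "mpol_var i0 :: ('n, 'k) mpol"
  let ?v = "w - Poly_Mapping.single i ?n"
  have "(\<Prod>k\<in>UNIV - {i}. ?s k ^ Poly_Mapping.lookup w k)
      = (\<Prod>k\<in>UNIV - {i}. mpol_var k ^ Poly_Mapping.lookup ?v k)"
    by (intro prod.cong) (auto simp: shear_def lookup_minus lookup_single when_def)
  also have "\<dots> = (\<Prod>k\<in>UNIV. mpol_var k ^ Poly_Mapping.lookup ?v k)"
    by (simp add: prod.remove[of UNIV i] lookup_minus)
  also have "\<dots> = Poly_Mapping.single ?v 1" by (rule prod_mpol_var_power)
  finally have rest: "(\<Prod>k\<in>UNIV - {i}. ?s k ^ Poly_Mapping.lookup w k) = Poly_Mapping.single ?v 1" .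
  have "?s i ^ ?n = (mpol_const c * ?z + ?x) ^ ?n"
    using assms by (simp add: shear_def add.commute)
  also have "\<dots> = (\<Sum>e\<le>?n. of_nat (?n choose e) * (mpol_const c * ?z) ^ e * ?x ^ (?n - e))"
    by (rule binomial_ring)
  also have "\<dots> = (\<Sum>e\<le>?n. Poly_Mapping.single
      (Poly_Mapping.single i0 e + Poly_Mapping.single i (?n - e)) (of_nat (?n choose e) * c ^ e))"
    by (intro sum.cong refl)
      (simp add: of_nat_mpol power_mult_distrib mpol_var_power mult_single mpol_const_mult_single
        mult.assoc flip: mpol_const_power)
  finally have "(\<Prod>k\<in>UNIV. ?s k ^ Poly_Mapping.lookup w k)
      = (\<Sum>e\<le>?n. Poly_Mapping.single
          (Poly_Mapping.single i0 e + Poly_Mapping.single i (?n - e) + ?v) (of_nat (?n choose e) * c ^ e))"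
    by (simp add: prod.remove[of UNIV i] rest sum_distrib_right mult_single)
  also have "\<dots> = (\<Sum>e\<le>?n. Poly_Mapping.single
      (w - Poly_Mapping.single i e + Poly_Mapping.single i0 e) (of_nat (?n choose e) * c ^ e))"
  proof (intro sum.cong refl)
    fix e assume "e \<in> {..?n}"
    hence "Poly_Mapping.single i0 e + Poly_Mapping.single i (?n - e) + ?v
        = w - Poly_Mapping.single i e + Poly_Mapping.single i0 e"
      by (intro poly_mapping_eqI) (auto simp: lookup_add lookup_minus lookup_single when_def)
    thus "Poly_Mapping.single (Poly_Mapping.single i0 e + Poly_Mapping.single i (?n - e) + ?v)
          (of_nat (?n choose e) * c ^ e)
        = Poly_Mapping.single (w - Poly_Mapping.single i e + Poly_Mapping.single i0 e)
          (of_nat (?n choose e) * c ^ e)" by simp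
  qed
  finally show ?thesis .
qed

text \<open>Comparing the coefficients at \<open>u - r e\<^sub>i + r e\<^sub>0\<close>, where \<open>r = u\<^sub>i mod q\<close>, of a polynomial and of
  its image under the transvection \<open>x\<^sub>i \<mapsto> x\<^sub>i + c z\<close> gives a polynomial in \<open>c\<close> of degree at most
  \<open>r < q\<close> which vanishes on the whole field and whose coefficient of \<open>c\<^sup>r\<close> is that of \<open>x\<^sup>u\<close>.\<close>

lemma card_dvd_leading_exponent:
  fixes f :: "('n::finite, 'k::{field,finite}) mpol"
  assumes inv: "\<And>a. a i0 \<noteq> 0 \<Longrightarrow> mpol_subst (shear i0 a) f - f \<in> frob_ideal N"
    and ord: "order_ge i0 (Poly_Mapping.lookup u i0) f"
    and u: "u \<in> Poly_Mapping.keys f" "\<And>i. Poly_Mapping.lookup u i < N"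
    and bound: "Poly_Mapping.lookup u i0 + CARD('k) \<le> N"
    and i: "i \<noteq> i0"
  shows "CARD('k) dvd Poly_Mapping.lookup u i"
proof (rule ccontr)
  let ?q = "CARD('k)"
  define r where "r = Poly_Mapping.lookup u i mod ?q"
  assume "\<not> ?q dvd Poly_Mapping.lookup u i"
  hence r0: "r \<noteq> 0" by (simp add: r_def mod_eq_0_iff_dvd)
  have rq: "r < ?q" unfolding r_def by (rule mod_less_divisor) simp
  have ru: "r \<le> Poly_Mapping.lookup u i" by (simp add: r_def)
  define t where "t = u - Poly_Mapping.single i r + Poly_Mapping.single i0 r"
  have ti0: "Poly_Mapping.lookup t i0 = Poly_Mapping.lookup u i0 + r"
    using i by (simp add: t_def lookup_add lookup_minus lookup_single)
  \<comment> \<open>The room of \<open>q\<close> orders assumed in \<open>bound\<close> keeps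
    \<open>t\<close> below \<open>N\<close>, so its coefficient is visible modulo the ideal.\<close>
  have tN: "Poly_Mapping.lookup t k < N" for k
  proof (cases "k = i0")
    case False
    hence "Poly_Mapping.lookup t k \<le> Poly_Mapping.lookup u k"
      by (simp add: t_def lookup_add lookup_minus lookup_single)
    thus ?thesis using u(2)[of k] by simp
  qed (use ti0 rq bound in simp)
  \<comment> \<open>\<open>P w e\<close> says that the term of index \<open>e\<close> in the
    expansion of the monomial \<open>w\<close> lands on \<open>t\<close>; \<open>p\<close> collects
    these contributions as a polynomial in \<open>c\<close>.\<close>
  define P where "P w e \<longleftrightarrow> w - Poly_Mapping.single i e + Poly_Mapping.single i0 e = t" for w e
  define p where "p = (\<Sum>w\<in>Poly_Mapping.keys f. \<Sum>e\<le>Poly_Mapping.lookup w i. Polynomial.monom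
    (if P w e then Poly_Mapping.lookup f w * of_nat (Poly_Mapping.lookup w i choose e) else 0) e)"
  have P_e: "e \<le> r" if "P w e" "w \<in> Poly_Mapping.keys f" for w e
  proof -
    have "Poly_Mapping.lookup (w - Poly_Mapping.single i e + Poly_Mapping.single i0 e) i0
        = Poly_Mapping.lookup t i0"
      using that(1) by (simp add: P_def)
    hence "Poly_Mapping.lookup w i0 + e = Poly_Mapping.lookup t i0"
      using i by (simp add: lookup_add lookup_minus lookup_single)
    moreover have "Poly_Mapping.lookup u i0 \<le> Poly_Mapping.lookup w i0"
      using ord that(2) by (simp add: order_ge_def)
    ultimately show ?thesis using ti0 by simp
  qed
  \<comment> \<open>Only \<open>u\<close> contributes to the coefficient of \<open>c ^ r\<close>.
    The bound on \<open>r\<close> makes the truncated subtraction reversible.\<close>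
  have P_r: "w = u" if "P w r" "r \<le> Poly_Mapping.lookup w i" for w
  proof (rule poly_mapping_eqI)
    fix k
    have "Poly_Mapping.lookup (w - Poly_Mapping.single i r + Poly_Mapping.single i0 r) k
        = Poly_Mapping.lookup (u - Poly_Mapping.single i r + Poly_Mapping.single i0 r) k"
      using that(1) by (simp add: P_def t_def)
    thus "Poly_Mapping.lookup w k = Poly_Mapping.lookup u k"
      using that(2) ru i
      by (cases "k = i"; cases "k = i0") (simp_all add: lookup_add lookup_minus lookup_single when_def)
  qed
  have "poly p c = Poly_Mapping.lookup f t" for c
  proof -
    let ?a = "\<lambda>k. if k = i0 then 1 else if k = i then c else 0"
    have "Poly_Mapping.lookup (mpol_subst (shear i0 ?a) f - f) t = 0"
      by (rule lookup_eq_0_if_in_frob_ideal[OF inv tN]) simp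
    moreover have "Poly_Mapping.lookup (mpol_subst (shear i0 ?a) f) t = poly p c"
      unfolding lookup_mpol_subst prod_shear_transvection[OF i] lookup_sum p_def poly_sum sum_distrib_left
      by (rule sum.cong[OF refl], rule sum.cong[OF refl]) (simp add: lookup_single poly_monom P_def)
    ultimately show ?thesis by (simp add: lookup_minus)
  qed
  moreover have degp: "Polynomial.degree p \<le> r"
    unfolding p_def
  proof (rule degree_sum_le[OF finite_keys], rule degree_sum_le[OF finite_atMost])
    fix w e assume "w \<in> Poly_Mapping.keys f"
    thus "Polynomial.degree (Polynomial.monom (if P w e
        then Poly_Mapping.lookup f w * of_nat (Poly_Mapping.lookup w i choose e) else 0) e) \<le> r"
      using P_e[of w e] by (cases "P w e") (auto intro: order.trans[OF degree_monom_le])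
  qed
  hence "Polynomial.degree (p - [:Poly_Mapping.lookup f t:]) < ?q"
    using degree_diff_le[of p r "[:Poly_Mapping.lookup f t:]"] rq by simp
  ultimately have "p - [:Poly_Mapping.lookup f t:] = 0"
    by (intro poly_eq_0_if_vanishes_on_finite_field) simp_all
  hence "p = [:Poly_Mapping.lookup f t:]" by simp
  hence "poly.coeff p r = 0" using r0 by (simp add: coeff_eq_0)
  moreover have "poly.coeff p r = Poly_Mapping.lookup f u"
  proof -
    define F where "F w e =
      (if P w e then Poly_Mapping.lookup f w * of_nat (Poly_Mapping.lookup w i choose e) else 0)" for w e
    have "poly.coeff p r = (\<Sum>w\<in>Poly_Mapping.keys f. \<Sum>e\<le>Poly_Mapping.lookup w i.
        if e = r then F w e else 0)"
      unfolding p_def Polynomial.coeff_sum Polynomial.coeff_monom F_def ..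
    also have "\<dots> = (\<Sum>w\<in>Poly_Mapping.keys f. if r \<le> Poly_Mapping.lookup w i then F w r else 0)"
      by (simp add: sum.delta)
    also have "\<dots> = (\<Sum>w\<in>Poly_Mapping.keys f. if w = u then Poly_Mapping.lookup f w else 0)"
    proof (rule sum.cong[OF refl])
      fix w
      have "(of_nat (Poly_Mapping.lookup u i choose r) :: 'k) = 1"
        unfolding r_def by (rule of_nat_choose_mod_card_eq_1)
      moreover have "P u r" by (simp add: P_def t_def)
      ultimately have "F u r = Poly_Mapping.lookup f u" by (simp add: F_def)
      moreover have "F w r = 0" if "w \<noteq> u" "r \<le> Poly_Mapping.lookup w i"
        using P_r[of w] that by (auto simp: F_def)
      ultimately show "(if r \<le> Poly_Mapping.lookup w i then F w r else 0)
          = (if w = u then Poly_Mapping.lookup f w else 0)"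
        using ru by (cases "w = u") simp_all
    qed
    also have "\<dots> = Poly_Mapping.lookup f u" using u(1) by simp
    finally show ?thesis .
  qed
  ultimately show False using u(1) by (simp add: in_keys_iff)
qed

text \<open>Scalings of \<open>z\<close> act diagonally on monomials and give divisibility of the
  \<open>z\<close>-exponent by \<open>q - 1\<close>. Unless that exponent is \<open>Q - 1\<close>,
  there is room below \<open>Q\<close> for the transvection argument of
  \<open>card_dvd_leading_exponent\<close>.\<close>

lemma leading_exponent_of_invariant:
  fixes f :: "('n::finite, 'k::{field,finite}) mpol"
  assumes inv: "\<And>a. a i0 \<noteq> 0 \<Longrightarrow> mpol_subst (shear i0 a) f - f \<in> frob_ideal (CARD('k) ^ m)"
    and ord: "order_ge i0 (Poly_Mapping.lookup u i0) f"
    and u: "u \<in> Poly_Mapping.keys f" "\<And>i. Poly_Mapping.lookup u i < CARD('k) ^ m"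
  shows "u \<in> inv_exponents TYPE('k) i0 m"
proof -
  let ?q = "CARD('k)"
  let ?Q = "?q ^ m"
  let ?j = "Poly_Mapping.lookup u i0"
  have q: "?q \<ge> 2" by (rule card_field_ge_2)
  have dvd: "(?q - 1) dvd ?j"
  proof (rule card_minus_1_dvd_if_power_eq_1)
    fix b :: 'k assume b: "b \<noteq> 0"
    let ?a = "\<lambda>i. if i = i0 then b else 0"
    have "Poly_Mapping.lookup (mpol_subst (shear i0 ?a) f - f) u = 0"
      by (rule lookup_eq_0_if_in_frob_ideal[OF inv u(2)]) (simp add: b)
    moreover have "Poly_Mapping.lookup (mpol_subst (shear i0 ?a) f) u
        = (\<Sum>w\<in>Poly_Mapping.keys f. if w = u then Poly_Mapping.lookup f w * b ^ Poly_Mapping.lookup w i0 else 0)"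
      unfolding lookup_mpol_subst prod_shear_scaling
      by (intro sum.cong refl) (simp add: lookup_single)
    ultimately have "Poly_Mapping.lookup f u * b ^ ?j = Poly_Mapping.lookup f u"
      using u(1) by (simp add: lookup_minus)
    thus "b ^ ?j = 1" using u(1) by (simp add: in_keys_iff)
  qed
  show ?thesis
  proof (cases "?j = ?Q - 1")
    case True
    thus ?thesis using u(2) by (simp add: inv_exponents_def)
  next
    case False
    \<comment> \<open>Both \<open>?j\<close> and \<open>?Q - 1\<close> are multiples of
      \<open>q - 1\<close>, so their positive difference is at least \<open>q - 1\<close>.\<close>
    have "(?q - 1) dvd (?Q - 1)" by (rule minus_1_dvd_power_minus_1)
    hence "(?q - 1) dvd (?Q - 1 - ?j)" using dvd by (rule dvd_diff_nat)
    moreover have "?Q - 1 - ?j > 0" using False u(2)[of i0] by linarith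
    ultimately have "?q - 1 \<le> ?Q - 1 - ?j" by (rule dvd_imp_le)
    hence "?j + ?q \<le> ?Q" using \<open>?Q - 1 - ?j > 0\<close> q by linarith
    thus ?thesis
      using card_dvd_leading_exponent[OF inv ord u] dvd u(2) by (simp add: inv_exponents_def)
  qed
qed

section \<open>The basis spans\<close>

text \<open>Induction on \<open>Q - j\<close>, where \<open>j\<close> bounds from below the
  \<open>z\<close>-exponents of the reduced monomials, those with all entries below
  \<open>Q\<close>. Each round removes the part of order \<open>j\<close>; once \<open>j\<close>
  reaches \<open>Q\<close>, no reduced monomial is left and the polynomial lies in the
  ideal.\<close>

lemma inv_basis_spans:
  fixes f :: "('n::finite, 'k::{field,finite}) mpol" and m d :: nat and i0 :: 'n
  defines "I \<equiv> (frob_ideal (CARD('k) ^ m) :: ('n, 'k) mpol set)"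
  defines "B \<equiv> {u \<in> inv_exponents TYPE('k) i0 m. (\<Sum>i\<in>UNIV. Poly_Mapping.lookup u i) = d}"
  assumes "\<And>a. a i0 \<noteq> 0 \<Longrightarrow> mpol_subst (shear i0 a) f - f \<in> I" and "f \<in> homogeneous_mpols d"
  shows "\<exists>c. f - (\<Sum>u\<in>B. mpol_const (c u) * inv_basis i0 m u) \<in> I"
proof -
  let ?Q = "CARD('k) ^ m"
  let ?red = "\<lambda>w::'n \<Rightarrow>\<^sub>0 nat. \<forall>i. Poly_Mapping.lookup w i < ?Q"
  let ?inv = "\<lambda>f. \<forall>a. a i0 \<noteq> 0 \<longrightarrow> mpol_subst (shear i0 a) f - f \<in> I"
  have I: "ideal I mpol_ring" unfolding I_def by (rule ideal_frob_ideal)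
  note closed = ideal_type_algebra_closed[OF I]
  have B: "u \<in> inv_exponents TYPE('k) i0 m" if "u \<in> B" for u using that by (simp add: B_def)
  have finB: "finite B" unfolding B_def by (simp add: finite_inv_exponents)
  have shear_I: "mpol_subst (shear i0 a) h \<in> I" if "h \<in> I" for a h
    using frob_ideal_subst_linear_form[of h m "shear_matrix i0 a"] that
    by (simp add: I_def linear_form_shear_matrix)
  have inv_I: "?inv h" if "h \<in> I" for h
    using that shear_I closed(5) by blast
  have inv_diff: "?inv (g - h)" if "?inv g" "?inv h" for g h
  proof (intro allI impI)
    fix a :: "'n \<Rightarrow> 'k" assume a: "a i0 \<noteq> 0"
    have "(mpol_subst (shear i0 a) g - g) - (mpol_subst (shear i0 a) h - h) \<in> I"
      by (rule closed(5)[OF that(1)[rule_format, of a, OF a] that(2)[rule_format, of a, OF a]])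
    thus "mpol_subst (shear i0 a) (g - h) - (g - h) \<in> I" by (simp add: algebra_simps)
  qed
  have inv_comb: "?inv (\<Sum>u\<in>B. mpol_const (c u) * inv_basis i0 m u)" for c
  proof (intro allI impI)
    fix a :: "'n \<Rightarrow> 'k" assume a: "a i0 \<noteq> 0"
    have "(\<Sum>u\<in>B. mpol_const (c u) * (mpol_subst (shear i0 a) (inv_basis i0 m u) - inv_basis i0 m u)) \<in> I"
      using inv_basis_shear[of _ i0 m a, OF B a] unfolding I_def[symmetric]
      by (intro ideal_type_algebra_sum[OF I] closed(3))
    thus "mpol_subst (shear i0 a) (\<Sum>u\<in>B. mpol_const (c u) * inv_basis i0 m u)
        - (\<Sum>u\<in>B. mpol_const (c u) * inv_basis i0 m u) \<in> I"
      by (simp add: mpol_subst_sum right_diff_distrib sum_subtractf)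
  qed
  have hom_comb: "(\<Sum>u\<in>B. mpol_const (c u) * inv_basis i0 m u) \<in> homogeneous_mpols d" for c :: "_ \<Rightarrow> 'k"
    using homogeneous_inv_basis[where 'k = 'k]
    by (intro homogeneous_mpols_sum homogeneous_mpols_const_mult) (auto simp: B_def)
  have "\<exists>c. f - (\<Sum>u\<in>B. mpol_const (c u) * inv_basis i0 m u) \<in> I"
    if "?inv f" "f \<in> homogeneous_mpols d"
      "\<And>w. w \<in> Poly_Mapping.keys f \<Longrightarrow> ?red w \<Longrightarrow> j \<le> Poly_Mapping.lookup w i0" for f j
    using that
  proof (induction "?Q - j" arbitrary: f j)
    case 0
    have "f \<in> I"
      unfolding I_def frob_ideal_eq
    proof (intro CollectI ballI)
      fix w assume "w \<in> Poly_Mapping.keys f"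
      hence "\<not> ?red w" using "0.prems"(3)[of w] "0.hyps"
        by (metis diff_is_0_eq leD order_trans)
      thus "\<exists>i. ?Q \<le> Poly_Mapping.lookup w i" by (auto simp: not_less)
    qed
    thus ?case by (intro exI[of _ "\<lambda>_. 0"]) simp
  next
    case (Suc k)
    \<comment> \<open>The reduced part of \<open>f\<close>. What is dropped lies in the shear-stable
      ideal, so invariance modulo the ideal survives.\<close>
    define f1 where "f1 = (\<Sum>w\<in>{w\<in>Poly_Mapping.keys f. ?red w}. Poly_Mapping.single w (Poly_Mapping.lookup f w))"
    have f1: "Poly_Mapping.lookup f1 w = (if ?red w then Poly_Mapping.lookup f w else 0)" for w
    proof -
      have "Poly_Mapping.lookup f1 w
          = (\<Sum>v\<in>{w\<in>Poly_Mapping.keys f. ?red w}. if v = w then Poly_Mapping.lookup f v else 0)"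
        unfolding f1_def lookup_sum by (intro sum.cong) (auto simp: lookup_single)
      thus ?thesis by (simp add: in_keys_iff)
    qed
    have keys_f1: "w \<in> Poly_Mapping.keys f1 \<longleftrightarrow> w \<in> Poly_Mapping.keys f \<and> ?red w" for w
      by (simp add: in_keys_iff f1)
    have ff1: "f - f1 \<in> I"
      unfolding I_def frob_ideal_eq by (auto simp: in_keys_iff lookup_minus f1 not_less split: if_splits)
    have inv1: "?inv f1" using inv_diff[OF Suc.prems(1) inv_I[OF ff1]] by simp
    have hom1: "f1 \<in> homogeneous_mpols d"
      using Suc.prems(2) by (simp add: homogeneous_mpols_def keys_f1)
    have ord1: "order_ge i0 j f1"
      using Suc.prems(3) by (simp add: order_ge_def keys_f1)
    \<comment> \<open>Leads are monic and all other terms have higher order, so the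
      order-\<open>j\<close> coefficients of \<open>f\<close> are the right multipliers.\<close>
    define c1 where "c1 u = (if Poly_Mapping.lookup u i0 = j then Poly_Mapping.lookup f u else 0)" for u
    define f2 where "f2 = f1 - (\<Sum>u\<in>B. mpol_const (c1 u) * inv_basis i0 m u)"
    have "?inv f2" unfolding f2_def by (rule inv_diff[OF inv1 inv_comb])
    moreover have "f2 \<in> homogeneous_mpols d"
      unfolding f2_def by (rule homogeneous_mpols_diff[OF hom1 hom_comb])
    moreover have "Suc j \<le> Poly_Mapping.lookup w i0" if "w \<in> Poly_Mapping.keys f2" for w
    proof (rule ccontr)
      assume "\<not> Suc j \<le> Poly_Mapping.lookup w i0"
      hence w: "Poly_Mapping.lookup w i0 \<le> j" by simp
      have "Poly_Mapping.lookup (\<Sum>u\<in>B. mpol_const (c1 u) * inv_basis i0 m u) w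
          = (\<Sum>u\<in>B. if u = w then c1 w else 0)"
        unfolding lookup_sum lookup_const_mult
        using lookup_has_lead[OF has_lead_inv_basis[OF B], of _ w] w
        by (intro sum.cong refl) (auto simp: c1_def)
      also have "\<dots> = (if w \<in> B then c1 w else 0)" using finB by simp
      also have "\<dots> = Poly_Mapping.lookup f1 w"
      proof (cases "w \<in> Poly_Mapping.keys f1")
        case True
        hence wj: "Poly_Mapping.lookup w i0 = j" using ord1 w by (auto simp: order_ge_def)
        \<comment> \<open>Every exponent of lowest order in an invariant indexes a basis element, so
          no order-\<open>j\<close> term escapes the subtraction.\<close>
        have "w \<in> inv_exponents TYPE('k) i0 m"
          using inv1 ord1 True wj unfolding I_def
          by (intro leading_exponent_of_invariant) (auto simp: keys_f1)
        hence "w \<in> B" using True hom1 by (simp add: B_def homogeneous_mpols_def)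
        thus ?thesis using True wj by (simp add: c1_def f1 keys_f1)
      next
        case False
        moreover have "?red w" if "w \<in> B" using B[OF that] by (simp add: inv_exponents_def)
        ultimately show ?thesis by (auto simp: c1_def in_keys_iff f1)
      qed
      finally have "Poly_Mapping.lookup f2 w = 0" by (simp add: f2_def lookup_minus)
      thus False using that by (simp add: in_keys_iff)
    qed
    moreover have "k = ?Q - Suc j" using Suc.hyps(2) by simp
    ultimately obtain c2 where c2: "f2 - (\<Sum>u\<in>B. mpol_const (c2 u) * inv_basis i0 m u) \<in> I"
      using Suc.hyps(1)[of "Suc j" f2] by blast
    have "(f - f1) + (f2 - (\<Sum>u\<in>B. mpol_const (c2 u) * inv_basis i0 m u)) \<in> I"
      using ff1 c2 by (rule closed(2))
    hence "f - (\<Sum>u\<in>B. mpol_const (c1 u + c2 u) * inv_basis i0 m u) \<in> I"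
      by (simp add: f2_def distrib_right sum.distrib algebra_simps)
    thus ?case by (intro exI[of _ "\<lambda>u. c1 u + c2 u"])
  qed
  from this[of f 0] show ?thesis using assms(3,4) by blast
qed

text \<open>\<open>GL_act P\<close> is invertible and preserves both degree and the ideal, so it
  carries the basis for the coordinate hyperplane to one for \<open>H\<close>.\<close>

lemma dim_quot_invariants_component:
  fixes H :: "('k::{field,finite} ^ 'n::finite) set" and m :: nat
  defines "I \<equiv> (frob_ideal (CARD('k) ^ m) :: ('n, 'k) mpol set)"
  assumes "is_hyperplane H"
  shows "ring.dim (mpol_ring Quot I) (quot_scalars I)
      (quot_invariants (GL_fixing H) I \<inter> quot_component I d)
    = card {u \<in> inv_exponents TYPE('k) (i0 :: 'n) m. (\<Sum>i\<in>UNIV. Poly_Mapping.lookup u i) = d}"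
    (is "_ = card ?B")
proof -
  have I: "ideal I mpol_ring" unfolding I_def by (rule ideal_frob_ideal)
  have act: "GL_act g f \<in> I" if "f \<in> I" for g f
    using that unfolding I_def by (rule frob_ideal_GL_act)
  let ?H0 = "{v :: 'k ^ 'n. v $ i0 = 0}"
  obtain P where P: "invertible P" and H: "H = (*v) P ` ?H0"
    using hyperplane_coordinates[OF assms(2)] by blast
  \<comment> \<open>Viewing the coordinate hyperplane as an image of \<open>H\<close> lets
    \<open>invariants_mod_conjugate\<close> run in the opposite direction too.\<close>
  have H0: "?H0 = (*v) (matrix_inv P) ` H"
    by (simp add: H image_image matrix_vector_mul_assoc matrix_inv_left P)
  let ?v = "\<lambda>u. GL_act P (inv_basis i0 m u) :: ('n, 'k) mpol"
  let ?s = "\<lambda>c. \<Sum>u\<in>?B. mpol_const (c u) * inv_basis i0 m u :: ('n, 'k) mpol"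
  have s: "(\<Sum>u\<in>?B. mpol_const (c u) * ?v u) = GL_act P (?s c)" for c
    by (simp add: GL_act_sum)
  have "I +>\<^bsub>mpol_ring\<^esub> GL_act P (?s c)
      \<in> (\<lambda>f. I +>\<^bsub>mpol_ring\<^esub> f) ` (invariants_mod (GL_fixing H) I \<inter> homogeneous_mpols d)" for c
  proof (intro imageI IntI)
    have "mpol_subst (shear i0 a) (?s c) - ?s c \<in> I" if a: "a i0 \<noteq> 0" for a
    proof -
      have "(\<Sum>u\<in>?B. mpol_const (c u) * (mpol_subst (shear i0 a) (inv_basis i0 m u) - inv_basis i0 m u)) \<in> I"
        using inv_basis_shear[of _ i0 m a, OF _ a] unfolding I_def[symmetric]
        by (intro ideal_type_algebra_sum[OF I] ideal_type_algebra_closed(3)[OF I]) auto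
      thus ?thesis by (simp add: mpol_subst_sum right_diff_distrib sum_subtractf)
    qed
    hence "GL_act (matrix_inv P) (GL_act P (?s c)) \<in> invariants_mod (GL_fixing ?H0) I"
      by (simp add: invariants_mod_coordinate_hyperplane GL_act_matrix_inv P)
    thus "GL_act P (?s c) \<in> invariants_mod (GL_fixing H) I"
      unfolding I_def by (rule invariants_mod_conjugate[OF invertible_matrix_inv[OF P] H0])
    show "GL_act P (?s c) \<in> homogeneous_mpols d"
      using homogeneous_inv_basis[where 'k = 'k]
      by (intro homogeneous_mpols_GL_act homogeneous_mpols_sum homogeneous_mpols_const_mult) auto
  qed
  moreover have "\<exists>c. I +>\<^bsub>mpol_ring\<^esub> f = I +>\<^bsub>mpol_ring\<^esub> GL_act P (?s c)"
    if f: "f \<in> invariants_mod (GL_fixing H) I" "f \<in> homogeneous_mpols d" for f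
  proof -
    define f0 where "f0 = GL_act (matrix_inv P) f"
    have f0: "GL_act P f0 = f" by (simp add: f0_def GL_act_matrix_inv P)
    have "f0 \<in> invariants_mod (GL_fixing ?H0) I"
      using f(1) unfolding I_def by (intro invariants_mod_conjugate[OF P H]) (simp add: f0)
    hence "\<And>a. a i0 \<noteq> 0 \<Longrightarrow> mpol_subst (shear i0 a) f0 - f0 \<in> I"
      by (simp add: invariants_mod_coordinate_hyperplane)
    moreover have "f0 \<in> homogeneous_mpols d" unfolding f0_def by (rule homogeneous_mpols_GL_act[OF f(2)])
    ultimately obtain c where "f0 - ?s c \<in> I"
      using inv_basis_spans[of i0 f0 m d] unfolding I_def by blast
    from act[OF this, of P] have "f - GL_act P (?s c) \<in> I" by (simp add: f0)
    thus ?thesis by (auto simp: coset_type_algebra_eq_iff[OF I])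
  qed
  ultimately have "quot_invariants (GL_fixing H) I \<inter> quot_component I d
      = range (\<lambda>c. I +>\<^bsub>mpol_ring\<^esub> (\<Sum>u\<in>?B. mpol_const (c u) * ?v u))"
    unfolding s unfolding I_def quot_invariants_component by blast
  moreover have "ring.dim (mpol_ring Quot I) (quot_scalars I)
      (range (\<lambda>c. I +>\<^bsub>mpol_ring\<^esub> (\<Sum>u\<in>?B. mpol_const (c u) * ?v u))) = card ?B"
  proof (rule dim_quotient_eq_card_basis[OF I])
    show "1 \<notin> I"
      by (simp add: I_def frob_ideal_eq)
    show "finite ?B" by (simp add: finite_inv_exponents)
    fix c assume "(\<Sum>u\<in>?B. mpol_const (c u) * ?v u) \<in> I"
    from act[OF this[unfolded s], of "matrix_inv P"] have "?s c \<in> I"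
      by (simp add: GL_act_matrix_inv P)
    thus "\<forall>u\<in>?B. c u = 0"
      unfolding I_def by (intro inv_basis_independent[of _ i0 m]) auto
  qed
  ultimately show ?thesis by simp
qed

section \<open>Counting exponents\<close>

lemma Abs_fps_card_eq_sum:
  assumes "finite B"
  shows "Abs_fps (\<lambda>d. of_nat (card {u \<in> B. s u = d})) = (\<Sum>u\<in>B. fps_X ^ s u :: rat fps)"
proof (rule fps_ext)
  fix d
  have "(\<Sum>u\<in>B. if s u = d then 1 else 0 :: rat) = of_nat (card {u \<in> B. s u = d})"
    using assms by (simp add: sum.If_cases Int_def)
  thus "fps_nth (Abs_fps (\<lambda>d. of_nat (card {u \<in> B. s u = d}))) d = fps_nth (\<Sum>u\<in>B. fps_X ^ s u :: rat fps) d"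
    by (simp add: fps_sum_nth fps_X_power_nth eq_commute cong: if_cong)
qed

lemma one_minus_fps_X_power_nonzero: "k > 0 \<Longrightarrow> 1 - fps_X ^ k \<noteq> (0 :: rat fps)"
proof
  assume "k > 0" "1 - fps_X ^ k = (0 :: rat fps)"
  moreover from \<open>k > 0\<close> have "fps_nth (1 - fps_X ^ k :: rat fps) 0 = 1"
    by (simp add: fps_X_power_nth)
  ultimately show False by (metis fps_zero_nth zero_neq_one)
qed

lemma qint_fps_X_power:
  assumes "k > 0"
  shows "qint l (fps_X ^ k :: rat fps) = (1 - fps_X ^ (k * l)) / (1 - fps_X ^ k)"
proof -
  have "1 - fps_X ^ (k * l) = (1 - fps_X ^ k) * qint l (fps_X ^ k :: rat fps)"
    by (simp add: qint_def power_mult one_diff_power_eq)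
  thus ?thesis using one_minus_fps_X_power_nonzero[OF assms] by simp
qed

lemma sum_multiples_eq_qint:
  fixes x :: "'a::comm_semiring_1"
  assumes "k > 0"
  shows "(\<Sum>a\<in>{a. a < k * l \<and> k dvd a}. x ^ a) = qint l (x ^ k)"
proof -
  have "{a. a < k * l \<and> k dvd a} = (*) k ` {..<l}" using assms by (auto simp: dvd_def)
  moreover have "inj_on ((*) k) {..<l}" using assms by (simp add: inj_on_def)
  ultimately show ?thesis by (simp add: sum.reindex qint_def power_mult)
qed

text \<open>By distributivity the sum over a box is a product of one sum per coordinate, with its
  own range at \<open>i0\<close>.\<close>

lemma sum_prod_box:
  fixes x :: "'a::comm_semiring_1" and i0 :: "'n::finite"
  assumes "finite S" "finite T"
  shows "(\<Sum>g\<in>Pi\<^sub>E UNIV (\<lambda>i. if i = i0 then S else T). x ^ (\<Sum>i\<in>UNIV. g i))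
    = (\<Sum>a\<in>S. x ^ a) * (\<Sum>a\<in>T. x ^ a) ^ (CARD('n) - 1)"
proof -
  let ?F = "\<lambda>i. if i = i0 then S else T"
  have "(\<Sum>g\<in>Pi\<^sub>E UNIV ?F. x ^ (\<Sum>i\<in>UNIV. g i)) = (\<Prod>i\<in>UNIV. \<Sum>a\<in>?F i. x ^ a)"
    using assms by (subst prod_sum_PiE) (auto simp: power_sum)
  also have "\<dots> = (\<Sum>a\<in>S. x ^ a) * (\<Prod>i\<in>UNIV - {i0}. \<Sum>a\<in>?F i. x ^ a)"
    by (simp add: prod.remove[of UNIV i0])
  also have "(\<Prod>i\<in>UNIV - {i0}. \<Sum>a\<in>?F i. x ^ a) = (\<Prod>i\<in>UNIV - {i0}. \<Sum>a\<in>T. x ^ a)"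
    by (rule prod.cong) auto
  finally show ?thesis by (simp add: card_Diff_singleton)
qed

text \<open>The two alternatives in \<open>inv_exponents\<close> overlap at
  \<open>z\<close>-exponent \<open>Q - 1\<close>. Excluding that value from the second box makes the
  union disjoint, so the generating functions add.\<close>

lemma lookup_image_inv_exponents:
  fixes i0 :: "'n::finite"
  defines "q \<equiv> CARD('k::{field,finite})"
  shows "Poly_Mapping.lookup ` inv_exponents TYPE('k) i0 m
    = Pi\<^sub>E UNIV (\<lambda>i. if i = i0 then {q ^ m - 1} else {..<q ^ m})
      \<union> Pi\<^sub>E UNIV (\<lambda>i. if i = i0 then {a. a < q ^ m - 1 \<and> (q - 1) dvd a} else {a. a < q ^ m \<and> q dvd a})"
    (is "?L = ?R")
proof (intro equalityI subsetI)
  fix g assume "g \<in> ?L"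
  then obtain u where u: "u \<in> inv_exponents TYPE('k) i0 m" "g = Poly_Mapping.lookup u" by blast
  show "g \<in> ?R"
  proof (cases "g i0 = q ^ m - 1")
    case True
    thus ?thesis using u by (intro UnI1) (auto simp: inv_exponents_def q_def)
  next
    case False
    moreover have "g i0 < q ^ m" using u by (simp add: inv_exponents_def q_def)
    ultimately have "g i0 < q ^ m - 1" by linarith
    thus ?thesis using u False by (intro UnI2) (auto simp: inv_exponents_def q_def)
  qed
next
  fix g assume g: "g \<in> ?R"
  define u where "u = Abs_poly_mapping g"
  have u: "Poly_Mapping.lookup u = g" by (simp add: u_def)
  have Q: "q ^ m > 0" by (simp add: q_def)
  from g have "u \<in> inv_exponents TYPE('k) i0 m"
  proof
    assume "g \<in> Pi\<^sub>E UNIV (\<lambda>i. if i = i0 then {q ^ m - 1} else {..<q ^ m})"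
    hence g: "g i \<in> (if i = i0 then {q ^ m - 1} else {..<q ^ m})" for i by blast
    have "g i < q ^ m" for i using g[of i] Q by (auto split: if_splits)
    thus ?thesis using g[of i0] by (simp add: inv_exponents_def u flip: q_def)
  next
    assume "g \<in> Pi\<^sub>E UNIV (\<lambda>i. if i = i0 then {a. a < q ^ m - 1 \<and> (q - 1) dvd a} else {a. a < q ^ m \<and> q dvd a})"
    hence g: "g i \<in> (if i = i0 then {a. a < q ^ m - 1 \<and> (q - 1) dvd a} else {a. a < q ^ m \<and> q dvd a})" for i
      by blast
    have "g i < q ^ m" for i using g[of i] by (auto split: if_splits)
    moreover have "(q - 1) dvd g i0" using g[of i0] by simp
    moreover have "q dvd g i" if "i \<noteq> i0" for i using g[of i] that by simp
    ultimately show ?thesis by (simp add: inv_exponents_def u flip: q_def)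
  qed
  thus "g \<in> ?L" using u by (metis imageI)
qed

lemma sum_inv_exponents:
  fixes i0 :: "'n::finite" and m :: nat
  defines "q \<equiv> CARD('k::{field,finite})"
  assumes "m \<ge> 1"
  shows "(\<Sum>u\<in>inv_exponents TYPE('k) i0 m. fps_X ^ (\<Sum>i\<in>UNIV. Poly_Mapping.lookup u i) :: rat fps)
    = qint (q ^ (m - 1)) (fps_X ^ q) ^ (CARD('n) - 1) * ((1 - fps_X ^ (q ^ m - 1)) / (1 - fps_X ^ (q - 1)))
      + fps_X ^ (q ^ m - 1) * qint (q ^ m) fps_X ^ (CARD('n) - 1)"
proof -
  let ?t = "fps_X :: rat fps"
  let ?A1 = "Pi\<^sub>E UNIV (\<lambda>i::'n. if i = i0 then {q ^ m - 1} else {..<q ^ m})"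
  let ?A2 = "Pi\<^sub>E UNIV (\<lambda>i::'n. if i = i0 then {a. a < q ^ m - 1 \<and> (q - 1) dvd a} else {a. a < q ^ m \<and> q dvd a})"
  have q: "q \<ge> 2" unfolding q_def by (rule card_field_ge_2)
  have inj: "inj_on Poly_Mapping.lookup (inv_exponents TYPE('k) i0 m)"
    by (rule inj_onI, rule poly_mapping_eqI, simp)
  have fin: "finite ?A1" "finite ?A2" by (auto intro!: finite_PiE)
  have disj: "?A1 \<inter> ?A2 = {}"
  proof -
    have "g i0 = q ^ m - 1" if "g \<in> ?A1" for g using PiE_mem[OF that, of i0] by simp
    moreover have "g i0 < q ^ m - 1" if "g \<in> ?A2" for g using PiE_mem[OF that, of i0] by simp
    ultimately show ?thesis by fastforce
  qed
  have "(\<Sum>u\<in>inv_exponents TYPE('k) i0 m. ?t ^ (\<Sum>i\<in>UNIV. Poly_Mapping.lookup u i))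
      = (\<Sum>g\<in>?A1 \<union> ?A2. ?t ^ (\<Sum>i\<in>UNIV. g i))"
    unfolding q_def lookup_image_inv_exponents[symmetric] by (simp add: sum.reindex[OF inj])
  also have "\<dots> = (\<Sum>g\<in>?A1. ?t ^ (\<Sum>i\<in>UNIV. g i)) + (\<Sum>g\<in>?A2. ?t ^ (\<Sum>i\<in>UNIV. g i))"
    by (rule sum.union_disjoint[OF fin disj])
  also have "(\<Sum>g\<in>?A1. ?t ^ (\<Sum>i\<in>UNIV. g i)) = ?t ^ (q ^ m - 1) * qint (q ^ m) ?t ^ (CARD('n) - 1)"
    by (subst sum_prod_box) (simp_all add: qint_def)
  also have "(\<Sum>g\<in>?A2. ?t ^ (\<Sum>i\<in>UNIV. g i))
      = (\<Sum>a\<in>{a. a < q ^ m - 1 \<and> (q - 1) dvd a}. ?t ^ a)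
        * (\<Sum>a\<in>{a. a < q ^ m \<and> q dvd a}. ?t ^ a) ^ (CARD('n) - 1)"
    by (rule sum_prod_box) simp_all
  also have "(\<Sum>a\<in>{a. a < q ^ m \<and> q dvd a}. ?t ^ a) = qint (q ^ (m - 1)) (?t ^ q)"
  proof -
    have "q ^ m = q * q ^ (m - 1)" using assms(2) by (simp flip: power_Suc)
    thus ?thesis using sum_multiples_eq_qint[of q ?t "q ^ (m - 1)"] q by simp
  qed
  also have "(\<Sum>a\<in>{a. a < q ^ m - 1 \<and> (q - 1) dvd a}. ?t ^ a) = (1 - ?t ^ (q ^ m - 1)) / (1 - ?t ^ (q - 1))"
  proof -
    \<comment> \<open>Since \<open>q - 1\<close> divides \<open>Q - 1\<close>, the multiples of
      \<open>q - 1\<close> below \<open>Q - 1\<close> are exactly the first \<open>l\<close>, and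
      the geometric series closes up.\<close>
    obtain l where l: "q ^ m - 1 = (q - 1) * l"
      using minus_1_dvd_power_minus_1[of q m] by blast
    have "q - 1 > 0" using q by simp
    thus ?thesis
      unfolding l by (simp only: sum_multiples_eq_qint qint_fps_X_power)
  qed
  finally show ?thesis by (simp add: mult.commute add.commute)
qed

theorem theorem1p1:
  fixes H :: "('k::{field,finite} ^ 'n::finite) set"
    and q n m :: nat
  assumes "q = CARD('k)" and "n = CARD('n)" and "m \<ge> 1"
    and "is_hyperplane H"
  defines "I \<equiv> (frob_ideal (q ^ m) :: ('n, 'k) mpol set)"
  shows "Hilb I (quot_invariants (GL_fixing H) I) =
           qint (q ^ (m - 1)) (fps_X ^ q) ^ (n - 1) * qt_binomial q m 1
           + fps_X ^ (q ^ m - 1) * qint (q ^ m) fps_X ^ (n - 1) * qt_binomial q m 0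
       \<and> Hilb I (quot_invariants (GL_fixing H) I) =
           ((1 - fps_X ^ (q ^ m)) / (1 - fps_X ^ q)) ^ (n - 1)
           * ((1 - fps_X ^ (q ^ m - 1)) / (1 - fps_X ^ (q - 1))
              + fps_X ^ (q ^ m - 1) * ((1 - fps_X ^ q) / (1 - fps_X)) ^ (n - 1))"
proof -
  let ?t = "fps_X :: rat fps"
  \<comment> \<open>Any index will do: the dimension formula holds for every choice of distinguished
    coordinate.\<close>
  define i0 :: 'n where "i0 = undefined"
  let ?G = "qint (q ^ (m - 1)) (?t ^ q)" and ?A = "(1 - ?t ^ (q ^ m - 1)) / (1 - ?t ^ (q - 1))"
  have q: "q \<ge> 2" unfolding assms(1) by (rule card_field_ge_2)
  have Q: "q * q ^ (m - 1) = q ^ m" using assms(3) by (simp flip: power_Suc)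
  have "Hilb I (quot_invariants (GL_fixing H) I)
      = Abs_fps (\<lambda>d. of_nat (card {u \<in> inv_exponents TYPE('k) i0 m. (\<Sum>i\<in>UNIV. Poly_Mapping.lookup u i) = d}))"
    unfolding Hilb_def I_def assms(1) dim_quot_invariants_component[OF assms(4), of m _ i0] ..
  also have "\<dots> = (\<Sum>u\<in>inv_exponents TYPE('k) i0 m. ?t ^ (\<Sum>i\<in>UNIV. Poly_Mapping.lookup u i))"
    by (rule Abs_fps_card_eq_sum[OF finite_inv_exponents])
  also have "\<dots> = ?G ^ (n - 1) * ?A + ?t ^ (q ^ m - 1) * qint (q ^ m) ?t ^ (n - 1)"
    unfolding assms(1,2) by (rule sum_inv_exponents[OF assms(3)])
  finally have Hilb: "Hilb I (quot_invariants (GL_fixing H) I)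
      = ?G ^ (n - 1) * ?A + ?t ^ (q ^ m - 1) * qint (q ^ m) ?t ^ (n - 1)" .
  have G: "?G = (1 - ?t ^ (q ^ m)) / (1 - ?t ^ q)"
    using qint_fps_X_power[of q "q ^ (m - 1)"] q Q by simp
  have qint_q: "qint q ?t = (1 - ?t ^ q) / (1 - ?t)"
    using qint_fps_X_power[of 1 q] by simp
  \<comment> \<open>The factorization of the \<open>Q\<close>-integer through
    \<open>Q = q * q ^ (m - 1)\<close>, multiplied by \<open>1 - t\<close> to telescope. It pulls
    the common power out of both summands and gives the second form.\<close>
  have "(1 - ?t) * qint (q ^ m) ?t = (1 - ?t) * (?G * qint q ?t)"
  proof -
    have "(1 - ?t) * qint (q ^ m) ?t = 1 - ?t ^ (q ^ m)"
      by (simp add: qint_def one_diff_power_eq)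
    also have "\<dots> = (1 - ?t ^ q) * ?G"
      unfolding qint_def Q[symmetric] power_mult by (rule one_diff_power_eq)
    also have "1 - ?t ^ q = (1 - ?t) * qint q ?t"
      unfolding qint_def by (rule one_diff_power_eq)
    finally show ?thesis by (simp add: mult_ac)
  qed
  hence "qint (q ^ m) ?t = ?G * qint q ?t"
    using one_minus_fps_X_power_nonzero[of 1] by simp
  hence "Hilb I (quot_invariants (GL_fixing H) I)
      = ?G ^ (n - 1) * (?A + ?t ^ (q ^ m - 1) * qint q ?t ^ (n - 1))"
    by (simp add: Hilb power_mult_distrib algebra_simps)
  moreover have "qt_binomial q m 0 = 1" "qt_binomial q m 1 = ?A"
    by (simp_all add: qt_binomial_def)
  ultimately show ?thesis
    unfolding G[symmetric] qint_q[symmetric] using Hilb by simp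
qed

end
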